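(* Let $n\ge 3$, let $\mathcal{D}$ be a dissection of a convex $n$-gon $P_n$ into $m$ pieces, and let $W_{\mathcal{D}}(x_1,\ldots,x_m)=(w_{i,j})_{1\le i,j\le n}$ be the associated weight matrix for the walks around $P_n$. Then $$\overline{w_{i,j}}=w_{j,i}\qquad\text{for all } 1\le i,j\le n,$$ i.e. $W_{\mathcal{D}}$ is a complementary symmetric matrix: $W_{\mathcal{D}}^t=\overline{W_{\mathcal{D}}}=(\overline{w_{i,j}})$.
   Context: $P_n$ is a convex $n$-gon ($n\ge3$) with vertices labelled $1,2,\ldots,n$ in counterclockwise order, labels being taken modulo $n$. A dissection $\mathcal{D}$ of $P_n$ is obtained by drawing $m-1$ ($m\ge 1$) pairwise noncrossing diagonals, which cut $P_n$ into $m$ polygons $\alpha_1,\ldots,\alpha_m$, called the pieces of the dissection; one writes $\mathcal{D}=\{\alpha_1,\ldots,\alpha_m\}$. If $\alpha_l$ has $d_l$ vertices, it is called a piece of degree $d_l$. For vertices $i,j$, a (counterclockwise) walk from $i$ to $j$ around $P_n$ is a sequence $w=(p_{i+1},p_{i+2},\ldots,p_{j-1})$ of pieces of $\mathcal{D}$, indexed by the vertices strictly between $i$ and $j$ when going counterclockwise from $i$ to $j$ (labels modulo $n$), such that: (i) $p_k$ is incident to vertex $k$ (i.e. $k$ is a vertex of $p_k$) for all $k\in\{i+1,\ldots,j-1\}$; (ii) each piece $\alpha\in\mathcal{D}$ of degree $d$ appears at most $d-2$ times among $p_{i+1},\ldots,p_{j-1}$. By convention, for $i=j$ there is no walk from $i$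 to $i$; for $j=i+1$ (modulo $n$) the empty sequence is the unique walk from $i$ to $i+1$. To each piece $\alpha_l$ an indeterminate $x_l=x(\alpha_l)$ is associated. The weight of a walk $w=(p_{i+1},\ldots,p_{j-1})$ is the monomial $x^w=\prod_{k=i+1}^{j-1}x(p_k)$ (the empty walk has weight $1$). The weight matrix $W_{\mathcal{D}}(x)=W_{\mathcal{D}}(x_1,\ldots,x_m)=(w_{i,j})_{1\le i,j\le n}$ has entries $w_{i,j}=\sum_{w} x^w\in\mathbb{Z}[x_1,\ldots,x_m]$, the sum over all walks $w$ from $i$ to $j$ (so $w_{i,i}=0$, $w_{i,i+1}=1$). Complementing map: let $\mathrm{Pol}_{\mathcal{D}}(x)=\{f\in\mathbb{Z}[x_1,\ldots,x_m]\mid \deg_{x_i} f\le d_i-2 \text{ for all } i\}$. The linear map $\phi_{\mathcal{D}}:\mathrm{Pol}_{\mathcal{D}}(x)\to\mathrm{Pol}_{\mathcal{D}}(x)$ is defined on monomials by $\phi_{\mathcal{D}}\left(\prod_{i=1}^m x_i^{a_i}\right)=\prod_{i=1}^m x_i^{d_i-2-a_i}$ and extended linearly. One writes $\bar f=\phi_{\mathcal{D}}(f)$. (By condition (ii), all $w_{i,j}$ lie in $\mathrm{Pol}_{\mathcal{D}}(x)$.) *)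

theory Defs
  imports "HOL-Library.Poly_Mapping" "HOL-Library.FuncSet" "Jordan_Normal_Form.Matrix"
begin

text \<open>
  The convex polygon is represented by its vertex labels \<open>1, \<dots>, n\<close>, in counterclockwise order.
  A chord joining \<open>a < b\<close> is the pair \<open>(a, b)\<close>; two chords cross (in their interiors) iff
  their end points strictly alternate around the polygon. A subpolygon is represented by its set
  of vertices, so its degree is its cardinality and incidence is membership.
\<close>

definition diagonals :: "nat \<Rightarrow> (nat \<times> nat) set" where
  "diagonals n = {(a, b). 1 \<le> a \<and> a + 1 < b \<and> b \<le> n \<and> (a, b) \<noteq> (1, n)}"

definition crossing :: "nat \<times> nat \<Rightarrow> nat \<times> nat \<Rightarrow> bool" where
  "crossing d e \<longleftrightarrow>
     fst d < fst e \<and> fst e < snd d \<and> snd d < snd e \<or>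
     fst e < fst d \<and> fst d < snd e \<and> snd e < snd d"

definition dissection :: "nat \<Rightarrow> (nat \<times> nat) set \<Rightarrow> bool" where
  "dissection n D \<longleftrightarrow> D \<subseteq> diagonals n \<and> (\<forall>d\<in>D. \<forall>e\<in>D. \<not> crossing d e)"

text \<open>
  A diagonal \<open>(a, b)\<close> cuts the polygon into the two closed sides with vertices
  \<open>{a..b}\<close> and \<open>{1..a} \<union> {b..n}\<close>. A piece is obtained by choosing one side of every diagonal
  (\<open>A\<close> collects the diagonals for which the side \<open>{a..b}\<close> is chosen) and intersecting these
  sides, provided that the intersection is a polygon, i.e. has at least three vertices.
  As the diagonals do not cross, the intersection has no corners besides vertices of the polygon.
\<close>

definition pieces :: "nat \<Rightarrow> (nat \<times> nat) set \<Rightarrow> nat set set" where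
  "pieces n D = {\<alpha>. \<exists>A\<subseteq>D.
      \<alpha> = {v \<in> {1..n}. (\<forall>(a, b)\<in>A. v \<in> {a..b}) \<and> (\<forall>(a, b)\<in>D - A. v \<in> {1..a} \<union> {b..n})} \<and>
      3 \<le> card \<alpha>}"

text \<open>The vertices strictly between \<open>i\<close> and \<open>j\<close> going counterclockwise from \<open>i\<close> to \<open>j\<close>, for
  \<open>i \<noteq> j\<close>.\<close>

definition between :: "nat \<Rightarrow> nat \<Rightarrow> nat \<Rightarrow> nat set" where
  "between n i j = (if i < j then {i<..<j} else {i<..n} \<union> {1..<j})"

text \<open>A walk is the family \<open>p\<close> of its pieces, indexed by the vertices between \<open>i\<close> and \<open>j\<close>
  (and \<open>undefined\<close> elsewhere, so that walks are equal iff they are equal as sequences).\<close>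

definition walks :: "nat \<Rightarrow> (nat \<times> nat) set \<Rightarrow> nat \<Rightarrow> nat \<Rightarrow> (nat \<Rightarrow> nat set) set" where
  "walks n D i j = (if i = j then {} else
     {p \<in> between n i j \<rightarrow>\<^sub>E pieces n D.
        (\<forall>k\<in>between n i j. k \<in> p k) \<and>
        (\<forall>\<alpha>\<in>pieces n D. card {k \<in> between n i j. p k = \<alpha>} \<le> card \<alpha> - 2)})"

text \<open>Integer polynomials with one indeterminate for every set of vertices; those attached to
  pieces are the ones that matter. An exponent vector has type \<open>nat set \<Rightarrow>\<^sub>0 nat\<close>.\<close>

type_synonym piece_poly = "(nat set \<Rightarrow>\<^sub>0 nat) \<Rightarrow>\<^sub>0 int"

definition indet :: "nat set \<Rightarrow> piece_poly" where
  "indet \<alpha> = Poly_Mapping.single (Poly_Mapping.single \<alpha> 1) 1"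

definition walk_weight :: "nat \<Rightarrow> nat \<Rightarrow> nat \<Rightarrow> (nat \<Rightarrow> nat set) \<Rightarrow> piece_poly" where
  "walk_weight n i j p = (\<Prod>k\<in>between n i j. indet (p k))"

definition weight :: "nat \<Rightarrow> (nat \<times> nat) set \<Rightarrow> nat \<Rightarrow> nat \<Rightarrow> piece_poly" where
  "weight n D i j = (\<Sum>p\<in>walks n D i j. walk_weight n i j p)"

text \<open>Library matrices are indexed from 0, vertices from 1.\<close>

definition weight_matrix :: "nat \<Rightarrow> (nat \<times> nat) set \<Rightarrow> piece_poly mat" where
  "weight_matrix n D = mat n n (\<lambda>(i, j). weight n D (i + 1) (j + 1))"

definition Pol :: "nat \<Rightarrow> (nat \<times> nat) set \<Rightarrow> piece_poly set" where
  "Pol n D = {f. \<forall>t\<in>Poly_Mapping.keys f. Poly_Mapping.keys t \<subseteq> pieces n D \<and>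
     (\<forall>\<alpha>\<in>pieces n D. Poly_Mapping.lookup t \<alpha> \<le> card \<alpha> - 2)}"

text \<open>The complementing map, meant for arguments in \<open>Pol n D\<close>: there, the subtractions of
  exponents do not truncate.\<close>

definition complementing :: "nat \<Rightarrow> (nat \<times> nat) set \<Rightarrow> piece_poly \<Rightarrow> piece_poly" where
  "complementing n D f = (\<Sum>t\<in>Poly_Mapping.keys f. of_int (Poly_Mapping.lookup f t) *
     (\<Prod>\<alpha>\<in>pieces n D. indet \<alpha> ^ (card \<alpha> - 2 - Poly_Mapping.lookup t \<alpha>)))"

definition complementary_symmetric ::
  "nat \<Rightarrow> (nat \<times> nat) set \<Rightarrow> piece_poly mat \<Rightarrow> bool" where
  "complementary_symmetric n D M \<longleftrightarrow> transpose_mat M = map_mat (complementing n D) M"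

lemma finite_pieces: "finite (pieces n D)"
  by (rule finite_subset[of _ "Pow {1..n}"]) (auto simp: pieces_def)

lemma finite_between: "finite (between n i j)"
  by (simp add: between_def)

lemma walk_weight_eq_single:
  "walk_weight n i j p =
     Poly_Mapping.single (\<Sum>k\<in>between n i j. Poly_Mapping.single (p k) 1) 1"
proof -
  have "finite S \<Longrightarrow> (\<Prod>k\<in>S. indet (p k)) =
      Poly_Mapping.single (\<Sum>k\<in>S. Poly_Mapping.single (p k) 1) 1" for S :: "nat set"
    by (induction S rule: finite_induct) (simp_all add: indet_def mult_single)
  then show ?thesis
    unfolding walk_weight_def using finite_between by blast
qed

lemma weight_in_Pol: "weight n D i j \<in> Pol n D"
proof -
  have "Poly_Mapping.keys t \<subseteq> pieces n D \<and>
      (\<forall>\<alpha>\<in>pieces n D. Poly_Mapping.lookup t \<alpha> \<le> card \<alpha> - 2)"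
    if "t \<in> Poly_Mapping.keys (weight n D i j)" for t
  proof -
    let ?B = "between n i j"
    from that obtain p where p: "p \<in> walks n D i j"
      and "t \<in> Poly_Mapping.keys (walk_weight n i j p)"
      unfolding weight_def using keys_sum[of "walk_weight n i j" "walks n D i j"] by blast
    then have t: "t = (\<Sum>k\<in>?B. Poly_Mapping.single (p k) 1)"
      by (simp add: walk_weight_eq_single)
    have l: "Poly_Mapping.lookup t \<alpha> = card {k \<in> ?B. p k = \<alpha>}" for \<alpha>
      using finite_between
      by (simp add: t lookup_sum lookup_single when_def sum.If_cases Int_def conj_commute)
    have "\<alpha> \<in> pieces n D" if a: "\<alpha> \<in> Poly_Mapping.keys t" for \<alpha>
    proof -
      from a have "{k \<in> ?B. p k = \<alpha>} \<noteq> {}"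
        by (metis l card.empty in_keys_iff)
      with p show ?thesis by (auto simp: walks_def split: if_splits)
    qed
    with p show ?thesis by (auto simp: l walks_def split: if_splits)
  qed
  then show ?thesis by (auto simp: Pol_def)
qed

lemma complementing_indet_monomial:
  assumes "\<And>\<alpha>. \<alpha> \<in> pieces n D \<Longrightarrow> e \<alpha> \<le> card \<alpha> - 2"
  shows "complementing n D (\<Prod>\<alpha>\<in>pieces n D. indet \<alpha> ^ e \<alpha>) =
    (\<Prod>\<alpha>\<in>pieces n D. indet \<alpha> ^ (card \<alpha> - 2 - e \<alpha>))"
proof -
  have pw: "indet \<alpha> ^ c = Poly_Mapping.single (Poly_Mapping.single \<alpha> c) 1" for \<alpha> c
    by (induction c) (simp_all add: indet_def mult_single flip: single_add)
  have *: "finite S \<Longrightarrow> (\<Prod>\<alpha>\<in>S. indet \<alpha> ^ e \<alpha>) =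
      Poly_Mapping.single (\<Sum>\<alpha>\<in>S. Poly_Mapping.single \<alpha> (e \<alpha>)) 1" for S
    by (induction S rule: finite_induct) (simp_all add: pw mult_single)
  show ?thesis
    unfolding *[OF finite_pieces] complementing_def
    by (auto simp: lookup_sum lookup_single when_def finite_pieces intro!: prod.cong)
qed

end

theory Submission imports Defs begin

text \<open>
  Every walk from \<open>i\<close> to \<open>j\<close> extends uniquely to an assignment of incident pieces to all vertices
  other than \<open>i\<close> and \<open>j\<close> that uses every piece \<open>\<alpha>\<close> exactly \<open>card \<alpha> - 2\<close> times. Restricting
  such assignments to the two sides of \<open>i, j\<close> therefore gives a bijection between the walks from
  \<open>i\<close> to \<open>j\<close> and those from \<open>j\<close> to \<open>i\<close> that complements multiplicities.

  Unique extension is proved by adding the diagonals one at a time. A new diagonal \<open>(a, b)\<close> splits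
  a piece \<open>\<gamma>\<close> into \<open>\<alpha>\<close> and \<open>\<beta>\<close>, and the vertices assigned to \<open>\<gamma>\<close> have to be distributed among
  \<open>\<alpha>\<close> and \<open>\<beta>\<close>; only \<open>a\<close> and \<open>b\<close> leave a choice. It is settled by the following invariant: exactly
  two vertices \<open>x, y\<close> of \<open>\<gamma>\<close> are not assigned to \<open>\<gamma>\<close>, and the chord \<open>xy\<close> separates two other
  vertices of \<open>\<gamma>\<close> iff one of them lies on the walk from \<open>i\<close> to \<open>j\<close> and the other does not. If
  \<open>x, y\<close> are on the same side of \<open>(a, b)\<close>, the capacities leave no choice; otherwise exactly one
  of \<open>a, b\<close> is on the walk, and the other one has to go to the opposite piece.
\<close>

subsection \<open>Splitting a piece along a chord\<close>

text \<open>The chord \<open>xy\<close> separates \<open>u\<close> from \<open>v\<close>. This form, meant for \<open>u, v \<notin> {x, y}\<close>, makes separation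
  additive in the chord without any condition on the order of the vertices.\<close>

definition sep :: "nat \<Rightarrow> nat \<Rightarrow> nat \<Rightarrow> nat \<Rightarrow> bool" where
  "sep x y u v \<longleftrightarrow> ((x < u) \<noteq> (y < u)) \<noteq> ((x < v) \<noteq> (y < v))"

lemma sep_commute: "sep x y u v = sep y x u v" "sep x y u v = sep x y v u"
  by (auto simp: sep_def)

text \<open>\<open>sep\<close> is the parity of the four comparisons between an end of one chord and
  an end of the other. Exchanging the chords negates all four, which preserves the parity.\<close>

lemma sep_swap:
  assumes "x \<noteq> u" "x \<noteq> v" "y \<noteq> u" "y \<noteq> v"
  shows "sep x y u v = sep u v x y"
proof -
  have "(u < x) = (\<not> x < u)" "(v < x) = (\<not> x < v)" "(u < y) = (\<not> y < u)" "(v < y) = (\<not> y < v)"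
    using assms by auto
  then show ?thesis unfolding sep_def by auto
qed

lemma sep_additive: "sep x z u v = (sep x y u v \<noteq> sep y z u v)"
  by (auto simp: sep_def)

text \<open>The invariant of the induction. It speaks only of pairs of vertices, so it does not fix
  which side of the chord \<open>xy\<close> belongs to \<open>L\<close>.\<close>

definition compatible :: "nat set \<Rightarrow> nat \<Rightarrow> nat \<Rightarrow> nat set \<Rightarrow> bool" where
  "compatible L x y S \<longleftrightarrow> (\<forall>u\<in>S. \<forall>v\<in>S. sep x y u v \<longleftrightarrow> (u \<in> L) \<noteq> (v \<in> L))"

lemma compatible_commute: "compatible L x y S = compatible L y x S"
  by (simp add: compatible_def sep_commute(1)[of x y])

text \<open>The axioms do not tell the inner side of the chord \<open>ab\<close> from the outer one.
  By this symmetry, facts about \<open>\<alpha>\<close> carry over to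
  \<open>\<beta>\<close>.\<close>

locale chord_split =
  fixes \<gamma> \<alpha> \<beta> :: "nat set" and a b :: nat
  assumes fin: "finite \<gamma>"
    and union: "\<alpha> \<union> \<beta> = \<gamma>"
    and inter: "\<alpha> \<inter> \<beta> = {a, b}"
    and distinct: "a \<noteq> b"
    and not_sep: "\<lbrakk>x \<in> \<alpha>; y \<in> \<alpha>; u \<in> \<beta>; v \<in> \<beta>; {x, y} \<inter> {u, v} = {}\<rbrakk> \<Longrightarrow> \<not> sep x y u v"
    and sep: "\<lbrakk>x \<in> \<alpha> - {a, b}; y \<in> \<beta> - {a, b}\<rbrakk> \<Longrightarrow> sep a b x y"
begin

lemma swap: "chord_split \<gamma> \<beta> \<alpha> a b"
proof
  show "\<not> sep x y u v" if "x \<in> \<beta>" "y \<in> \<beta>" "u \<in> \<alpha>" "v \<in> \<alpha>" "{x, y} \<inter> {u, v} = {}" for x y u v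
    using not_sep[of u v x y] sep_swap[of x u v y] that by auto
  show "sep a b x y" if "x \<in> \<beta> - {a, b}" "y \<in> \<alpha> - {a, b}" for x y
    using sep that sep_commute(2) by blast
qed (use fin union inter distinct in auto)

lemma fin_sides: "finite \<alpha>" "finite \<beta>"
  using fin union by auto

lemma ends: "a \<in> \<alpha>" "b \<in> \<alpha>" "a \<in> \<beta>" "b \<in> \<beta>"
  using inter by auto

lemma card_sides: "2 \<le> card \<alpha>" "2 \<le> card \<beta>" "card \<gamma> + 2 = card \<alpha> + card \<beta>"
proof -
  have "card {a, b} = 2" using distinct by simp
  then show "2 \<le> card \<alpha>" "2 \<le> card \<beta>" "card \<gamma> + 2 = card \<alpha> + card \<beta>"
    using inter union fin_sides card_Un_Int[of \<alpha> \<beta>]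
      card_mono[of \<alpha> "{a, b}"] card_mono[of \<beta> "{a, b}"] by auto
qed

text \<open>The admissible ways to hand the vertices assigned to \<open>\<gamma>\<close> over to
  \<open>\<alpha>\<close> and \<open>\<beta>\<close>, filling both to capacity; \<open>x\<close> and
  \<open>y\<close> are the two vertices of \<open>\<gamma>\<close> not assigned to it.\<close>

definition splits :: "nat \<Rightarrow> nat \<Rightarrow> nat set \<Rightarrow> nat set \<Rightarrow> bool" where
  "splits x y U V \<longleftrightarrow> U \<subseteq> \<alpha> \<and> V \<subseteq> \<beta> \<and> U \<inter> V = {} \<and> U \<union> V = \<gamma> - {x, y} \<and>
     card U = card \<alpha> - 2 \<and> card V = card \<beta> - 2"

text \<open>\<open>U\<close> fits into \<open>\<alpha> - {x, y}\<close>, which has just the size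
  required of \<open>U\<close>. So \<open>\<alpha>\<close> takes every vertex it can, and
  \<open>\<beta>\<close> gets the rest.\<close>

lemma splits_same_side:
  assumes "splits x y U V" "x \<noteq> y" "x \<in> \<alpha>" "y \<in> \<alpha>"
  shows "U = \<alpha> - {x, y}" "V = \<beta> - {a, b}"
proof -
  have s: "U \<subseteq> \<alpha>" "V \<subseteq> \<beta>" "U \<inter> V = {}" "U \<union> V = \<gamma> - {x, y}" "card U = card \<alpha> - 2"
    using assms by (auto simp: splits_def)
  have "card (\<alpha> - {x, y}) = card \<alpha> - 2"
    using assms fin_sides by (simp add: card_Diff_subset)
  moreover have "U \<subseteq> \<alpha> - {x, y}" using s by auto
  ultimately show U: "U = \<alpha> - {x, y}"
    using s(5) fin_sides by (metis card_subset_eq finite_Diff)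
  have "v \<in> \<beta> - {a, b}" if "v \<in> V" for v
  proof -
    have "v \<in> \<beta>" "v \<notin> U" "v \<notin> {x, y}" using that s by auto
    then show ?thesis using U inter by auto
  qed
  moreover have "v \<in> V" if "v \<in> \<beta> - {a, b}" for v
  proof -
    have "v \<notin> \<alpha>" "v \<in> \<gamma>" using that inter union by auto
    moreover from this have "v \<noteq> x" "v \<noteq> y" using assms by auto
    ultimately show ?thesis using s by blast
  qed
  ultimately show "V = \<beta> - {a, b}" by blast
qed

lemma splits_swap: "splits x y U V \<Longrightarrow> chord_split.splits \<gamma> \<beta> \<alpha> x y V U"
  by (auto simp: splits_def chord_split.splits_def[OF swap])

lemma splits_commute: "splits x y U V = splits y x U V"
  by (simp add: splits_def insert_commute)

text \<open>By counting, \<open>U\<close> omits two vertices of \<open>\<alpha>\<close>. One is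
  \<open>x\<close>; the other one, \<open>c\<close>, still has to be assigned, hence goes to
  \<open>V\<close> and lies on both sides.\<close>

lemma splits_missing:
  assumes "splits x y U V" "x \<in> \<alpha> - {a, b}" "y \<in> \<beta> - {a, b}"
  obtains c where "c \<in> {a, b}" "U = \<alpha> - {x, c}" "c \<in> V"
proof -
  have s: "U \<subseteq> \<alpha>" "V \<subseteq> \<beta>" "U \<inter> V = {}" "U \<union> V = \<gamma> - {x, y}" "card U = card \<alpha> - 2"
    using assms by (auto simp: splits_def)
  have "finite U" using s(1) fin_sides finite_subset by blast
  then have "card (\<alpha> - U) = 2"
    using s card_sides by (simp add: card_Diff_subset)
  moreover have "x \<in> \<alpha> - U" using assms s by auto
  ultimately obtain c where c: "\<alpha> - U = {x, c}" "c \<noteq> x"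
    by (metis card_2_iff doubleton_eq_iff insertE singletonD)
  have "c \<noteq> y" using assms c inter by auto
  have "c \<in> \<alpha>" "c \<notin> U" using c(1) by auto
  then have "c \<in> U \<union> V" unfolding s(4) using c(2) \<open>c \<noteq> y\<close> union by auto
  then have "c \<in> V" using \<open>c \<notin> U\<close> by simp
  then have "c \<in> {a, b}" unfolding inter[symmetric] using \<open>c \<in> \<alpha>\<close> s(2) by auto
  moreover have "U = \<alpha> - {x, c}" unfolding c(1)[symmetric] using s(1) by auto
  ultimately show ?thesis using that \<open>c \<in> V\<close> by simp
qed

text \<open>Each side leaves one end of \<open>ab\<close> to the other side, and as \<open>U\<close>
  and \<open>V\<close> are disjoint these ends differ. So only two candidates for \<open>U\<close>
  and \<open>V\<close> remain.\<close>

lemma splits_cross: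
  assumes "splits x y U V" "x \<in> \<alpha> - {a, b}" "y \<in> \<beta> - {a, b}"
  obtains c d where "{c, d} = {a, b}" "c \<noteq> d" "U = \<alpha> - {x, c}" "V = \<beta> - {y, d}"
proof -
  from assms obtain c where c: "c \<in> {a, b}" "U = \<alpha> - {x, c}" "c \<in> V"
    by (rule splits_missing)
  from chord_split.splits_missing[OF swap splits_swap[OF splits_commute[THEN iffD1, OF assms(1)]]] assms
  obtain d where d: "d \<in> {a, b}" "V = \<beta> - {y, d}" "d \<in> U" by blast
  have "c \<noteq> d" using c d by auto
  then show ?thesis using that c d by blast
qed

lemma location_cases:
  assumes "x \<in> \<gamma>" "y \<in> \<gamma>"
  obtains "x \<in> \<alpha>" "y \<in> \<alpha>" | "x \<in> \<beta>" "y \<in> \<beta>"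
    | "x \<in> \<alpha> - {a, b}" "y \<in> \<beta> - {a, b}" | "y \<in> \<alpha> - {a, b}" "x \<in> \<beta> - {a, b}"
  using assms union inter by blast

text \<open>The chords \<open>xy\<close> and \<open>ab\<close> cross, so the invariant can be read
  off at the pair \<open>a\<close>, \<open>b\<close>.\<close>

lemma ends_on_different_sides:
  assumes "compatible L x y (\<gamma> - {x, y})" "x \<in> \<alpha> - {a, b}" "y \<in> \<beta> - {a, b}"
  shows "(a \<in> L) \<noteq> (b \<in> L)"
proof -
  have "sep x y a b" using sep[of x y] assms sep_swap[of x a b y] by auto
  moreover have "a \<in> \<gamma> - {x, y}" "b \<in> \<gamma> - {x, y}" using assms ends union by auto
  ultimately show ?thesis using assms(1) by (auto simp: compatible_def)
qed

text \<open>If \<open>x\<close> and \<open>y\<close> are on one side of \<open>ab\<close>, then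
  \<open>U\<close> is forced. Otherwise the two candidates differ only at \<open>a\<close> and
  \<open>b\<close>, one of which lies in \<open>L\<close>, where \<open>U\<close> and
  \<open>U'\<close> agree.\<close>

lemma splits_unique:
  assumes "x \<in> \<gamma>" "y \<in> \<gamma>" "x \<noteq> y" and comp: "compatible L x y (\<gamma> - {x, y})"
    and s: "splits x y U V" "splits x y U' V'" and agree: "U \<inter> L = U' \<inter> L"
  shows "U = U'"
proof -
  \<comment> \<open>Here \<open>x\<close> and \<open>y\<close> are bound anew, so that the mirrored
    case can use the fact with the two exchanged.\<close>
  have cross: "U = U'"
    if "x \<in> \<alpha> - {a, b}" "y \<in> \<beta> - {a, b}" "splits x y U V" "splits x y U' V'"
      "compatible L x y (\<gamma> - {x, y})" for x y
  proof -
    from splits_cross[OF that(3,1,2)] obtain c d where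
      c: "{c, d} = {a, b}" "U = \<alpha> - {x, c}" by metis
    from splits_cross[OF that(4,1,2)] obtain c' d' where
      c': "{c', d'} = {a, b}" "U' = \<alpha> - {x, c'}" by metis
    have "c = c'"
    proof (rule ccontr)
      assume ne: "c \<noteq> c'"
      then have "{c, c'} = {a, b}" using c c' by (auto simp: doubleton_eq_iff)
      then have "(c \<in> L) \<noteq> (c' \<in> L)" "c \<in> \<alpha>" "c' \<in> \<alpha>" "c \<noteq> x" "c' \<noteq> x"
        using ends_on_different_sides[OF that(5,1,2)] ends that(1) by (auto simp: doubleton_eq_iff)
      \<comment> \<open>\<open>c\<close> lies in \<open>U'\<close> but not in \<open>U\<close>, and
        \<open>c'\<close> lies in \<open>U\<close> but not in \<open>U'\<close>.\<close>
      moreover have "c \<notin> L" "c' \<notin> L"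
        using agree calculation ne unfolding c(2) c'(2) by blast+
      ultimately show False by blast
    qed
    then show ?thesis using c c' by simp
  qed
  from assms(1,2) show ?thesis
  proof (cases rule: location_cases)
    case 1
    then show ?thesis using splits_same_side[OF s(1)] splits_same_side[OF s(2)] assms(3) by simp
  next
    case 2
    note sw = chord_split.splits_same_side[OF swap splits_swap]
    show ?thesis using sw[OF s(1) assms(3) 2] sw[OF s(2) assms(3) 2] by simp
  next
    case 3
    then show ?thesis using cross[OF _ _ s comp] by simp
  next
    case 4
    then show ?thesis
      using cross[of y x] s comp splits_commute[of x y] compatible_commute[of L x y]
      by (simp add: insert_commute)
  qed
qed

text \<open>The pair missing from \<open>\<alpha>\<close> is \<open>x\<close>, \<open>y\<close>, or
  \<open>a\<close>, \<open>b\<close>, or one of \<open>x\<close>, \<open>y\<close> with an end of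
  \<open>ab\<close>. In passing to the new pair the chord changes only within
  \<open>\<beta>\<close>, which does not affect how it separates vertices of
  \<open>U\<close>.\<close>

lemma splits_compatible:
  assumes "x \<in> \<gamma>" "y \<in> \<gamma>" "x \<noteq> y" and comp: "compatible L x y (\<gamma> - {x, y})"
    and s: "splits x y U V"
    and U: "U = \<alpha> - {x', y'}" "x' \<in> \<alpha>" "y' \<in> \<alpha>" "x' \<noteq> y'"
  shows "compatible L x' y' U"
proof -
  have compU: "compatible L x y U"
    using comp s unfolding compatible_def splits_def by blast
  have pair: "{x', y'} = {c, d}" if "U = \<alpha> - {c, d}" "c \<in> \<alpha>" "d \<in> \<alpha>" for c d
    using U that by blast
  have transfer: "compatible L x' y' U" if "compatible L c d U" "{x', y'} = {c, d}" for c d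
    using that by (metis compatible_commute doubleton_eq_iff)
  have cross: "compatible L x' y' U" if "x \<in> \<alpha> - {a, b}" "y \<in> \<beta> - {a, b}" "splits x y U V"
    "compatible L x y U" for x y
  proof -
    from splits_cross[OF that(3,1,2)] obtain c d where
      c: "{c, d} = {a, b}" "U = \<alpha> - {x, c}" by metis
    have cc: "c \<in> \<alpha>" "c \<in> \<beta>" using c ends by auto
    have "sep x c u v = sep x y u v" if "u \<in> U" "v \<in> U" for u v
    proof -
      have uv: "u \<in> \<alpha>" "v \<in> \<alpha>" "u \<noteq> c" "v \<noteq> c" "y \<notin> \<alpha>"
        using that c \<open>y \<in> \<beta> - {a, b}\<close> inter by auto
      then have "u \<noteq> y" "v \<noteq> y" by auto
      then have "\<not> sep c y u v"
        using chord_split.not_sep[OF swap, of c y u v] cc uv \<open>y \<in> \<beta> - {a, b}\<close> by auto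
      \<comment> \<open>Moving the end \<open>y\<close> to \<open>c\<close> changes the separation
        by that of the chord \<open>cy\<close>, which lies in \<open>\<beta>\<close> and separates
        no two vertices of \<open>U\<close>.\<close>
      then show ?thesis using sep_additive[of x y u v c] by simp
    qed
    then have "compatible L x c U" using that(4) by (auto simp: compatible_def)
    then show ?thesis using transfer pair c(2) cc(1) that(1) by simp
  qed
  from assms(1,2) show ?thesis
  proof (cases rule: location_cases)
    case 1
    then show ?thesis
      using transfer[OF compU pair] splits_same_side(1)[OF s assms(3)] by simp
  next
    case 2
    have Ueq: "U = \<alpha> - {a, b}"
      using chord_split.splits_same_side(2)[OF swap splits_swap[OF s] assms(3) 2] .
    \<comment> \<open>Both chords have their ends in \<open>\<beta>\<close>, so neither separates
      two vertices of \<open>\<alpha>\<close> outside \<open>\<beta>\<close>.\<close>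
    have "sep a b u v = sep x y u v" if "u \<in> U" "v \<in> U" for u v
    proof -
      have uv: "u \<in> \<alpha>" "v \<in> \<alpha>" "u \<notin> \<beta>" "v \<notin> \<beta>" using that Ueq inter by auto
      then have "{a, b} \<inter> {u, v} = {}" "{x, y} \<inter> {u, v} = {}" using 2 ends by auto
      then show ?thesis
        using chord_split.not_sep[OF swap] uv 2 ends by blast
    qed
    then have "compatible L a b U" using compU by (auto simp: compatible_def)
    then show ?thesis using transfer pair Ueq ends by simp
  next
    case 3
    then show ?thesis using cross s compU by simp
  next
    case 4
    then show ?thesis
      using cross[of y x] s compU splits_commute[of x y] compatible_commute[of L x y] by simp
  qed
qed

text \<open>\<open>F\<close> and \<open>G\<close> are the parts of \<open>U\<close> and
  \<open>V\<close> prescribed on \<open>L\<close>. The forced \<open>U\<close> and \<open>V\<close>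
  fit this prescription once it is known that \<open>G\<close> takes neither \<open>a\<close> nor
  \<open>b\<close>.\<close>

lemma splits_exist_same_side:
  assumes "x \<in> \<alpha>" "y \<in> \<alpha>" "x \<noteq> y" and comp: "compatible L x y (\<gamma> - {x, y})"
    and FG: "F \<subseteq> \<alpha>" "G \<subseteq> \<beta>" "F \<inter> G = {}" "F \<union> G = L \<inter> (\<gamma> - {x, y})"
    and card: "card G \<le> card \<beta> - 2"
  shows "\<exists>U V. splits x y U V \<and> U \<inter> L = F \<and> V \<inter> L = G"
proof -
  define U V where "U = \<alpha> - {x, y}" and "V = \<beta> - {a, b}"
  have "U \<union> V = \<gamma> - {x, y}"
    using assms(1,2) union inter by (auto simp: U_def V_def)
  moreover have "U \<inter> V = {}" using inter by (auto simp: U_def V_def)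
  moreover have "card U = card \<alpha> - 2" "card V = card \<beta> - 2"
    using assms(1-3) distinct fin_sides ends by (auto simp: U_def V_def card_Diff_subset)
  ultimately have s: "splits x y U V" by (auto simp: splits_def U_def V_def)
  \<comment> \<open>If \<open>c\<close> were in \<open>G\<close>, it would be in \<open>L\<close>.
    The chord \<open>xy\<close> does not separate \<open>c\<close> from \<open>V\<close>, so all of
    \<open>V\<close> would lie in \<open>L\<close> and thus in \<open>G\<close>, which would then
    exceed its capacity by at least one.\<close>
  have nG: "c \<notin> G" if "c \<in> {a, b}" for c
  proof
    assume c: "c \<in> G"
    have cL: "c \<in> L" "c \<in> \<gamma> - {x, y}" "c \<in> \<beta>" using c FG by auto
    have "V \<subseteq> G"
    proof
      fix v assume v: "v \<in> V"
      then have v': "v \<in> \<beta>" "v \<notin> \<alpha>" "v \<in> \<gamma> - {x, y}"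
        using inter union assms(1,2) by (auto simp: V_def)
      then have "\<not> sep x y c v" using not_sep[of x y c v] cL assms(1,2) by auto
      then have "v \<in> L" using comp cL v' by (auto simp: compatible_def)
      then show "v \<in> G" using FG v' by blast
    qed
    then have "insert c V \<subseteq> G" using c by auto
    moreover have "finite G" using FG fin_sides finite_subset by blast
    ultimately have "card (insert c V) \<le> card G" by (rule card_mono[rotated])
    moreover have "c \<notin> V" "finite V" using that fin_sides by (auto simp: V_def)
    ultimately show False using card \<open>card V = _\<close> by simp
  qed
  have "U \<inter> L = F"
  proof -
    have "U \<inter> L \<subseteq> F"
    proof
      fix u assume u: "u \<in> U \<inter> L"
      then have "u \<in> F \<union> G" using FG(4) s by (auto simp: splits_def)
      then show "u \<in> F" using u nG inter FG(2) by (auto simp: U_def)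
    qed
    moreover have "F \<subseteq> U \<inter> L" using FG by (auto simp: U_def)
    ultimately show ?thesis by blast
  qed
  moreover have "V \<inter> L = G"
  proof -
    have "V \<inter> L \<subseteq> G"
    proof
      fix u assume u: "u \<in> V \<inter> L"
      then have "u \<in> F \<union> G" using FG(4) s by (auto simp: splits_def)
      then show "u \<in> G" using u inter FG(1) by (auto simp: V_def)
    qed
    moreover have "G \<subseteq> V \<inter> L" using FG nG by (auto simp: V_def)
    ultimately show ?thesis by blast
  qed
  ultimately show ?thesis using s by blast
qed

lemma splits_exist_cross:
  assumes xy: "x \<in> \<alpha> - {a, b}" "y \<in> \<beta> - {a, b}" and comp: "compatible L x y (\<gamma> - {x, y})"
    and FG: "F \<subseteq> \<alpha>" "G \<subseteq> \<beta>" "F \<inter> G = {}" "F \<union> G = L \<inter> (\<gamma> - {x, y})"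
  shows "\<exists>U V. splits x y U V \<and> U \<inter> L = F \<and> V \<inter> L = G"
proof -
  have "(a \<in> L) \<noteq> (b \<in> L)" using ends_on_different_sides comp xy by blast
  then obtain p q where pq: "{p, q} = {a, b}" "p \<noteq> q" "p \<in> L" "q \<notin> L"
    using distinct by (cases "a \<in> L") (blast, blast)
  \<comment> \<open>\<open>c\<close> will be left out of \<open>U\<close> and \<open>d\<close> out
    of \<open>V\<close>. The end \<open>p\<close> in \<open>L\<close> is left out of the side to
    which the prescription does not assign it, and \<open>q\<close> takes the other role.\<close>
  obtain c d where cd: "{c, d} = {a, b}" "c \<noteq> d" "c \<in> L \<Longrightarrow> c \<in> G" "d \<in> L \<Longrightarrow> d \<in> F"
  proof -
    have "p \<in> {a, b}" using pq(1) by blast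
    then have "p \<in> F \<union> G" using pq(3) FG(4) xy ends union by blast
    then show ?thesis
    proof
      assume "p \<in> F"
      then show ?thesis using that[of q p] pq by (simp add: insert_commute)
    next
      assume "p \<in> G"
      then show ?thesis using that[of p q] pq by simp
    qed
  qed
  have e: "c \<in> \<alpha>" "d \<in> \<alpha>" "c \<in> \<beta>" "d \<in> \<beta>" "c \<noteq> x" "d \<noteq> x" "c \<noteq> y" "d \<noteq> y"
    "\<alpha> \<inter> \<beta> = {c, d}" "x \<notin> \<beta>" "y \<notin> \<alpha>"
    using cd(1)[symmetric] ends xy inter by auto
  define U V where "U = \<alpha> - {x, c}" and "V = \<beta> - {y, d}"
  have "U \<union> V = \<gamma> - {x, y}" using e cd(2) union xy by (auto simp: U_def V_def)
  moreover have "U \<inter> V = {}" using e by (auto simp: U_def V_def)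
  moreover have "card U = card \<alpha> - 2" "card V = card \<beta> - 2"
    using xy fin_sides e by (auto simp: U_def V_def card_Diff_subset)
  ultimately have s: "splits x y U V" by (auto simp: splits_def U_def V_def)
  have "c \<notin> F" "d \<notin> G" using cd FG by blast+
  have "U \<inter> L = F"
  proof -
    have "U \<inter> L \<subseteq> F"
    proof
      fix u assume u: "u \<in> U \<inter> L"
      then have "u \<in> F \<union> G" using FG(4) s by (auto simp: splits_def)
      moreover have "u \<in> F" if "u \<in> G"
      proof -
        have "u \<in> \<alpha> \<inter> \<beta>" "u \<noteq> c" using u that FG(2) by (auto simp: U_def)
        then have "u = d" using e(9) by blast
        then show ?thesis using cd(4) u by blast
      qed
      ultimately show "u \<in> F" by blast
    qed
    moreover have "F \<subseteq> U \<inter> L" using FG(1,4) \<open>c \<notin> F\<close> by (auto simp: U_def)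
    ultimately show ?thesis by blast
  qed
  moreover have "V \<inter> L = G"
  proof -
    have "V \<inter> L \<subseteq> G"
    proof
      fix u assume u: "u \<in> V \<inter> L"
      then have "u \<in> F \<union> G" using FG(4) s by (auto simp: splits_def)
      moreover have "u \<in> G" if "u \<in> F"
      proof -
        have "u \<in> \<alpha> \<inter> \<beta>" "u \<noteq> d" using u that FG(1) by (auto simp: V_def)
        then have "u = c" using e(9) by blast
        then show ?thesis using cd(3) u by blast
      qed
      ultimately show "u \<in> G" by blast
    qed
    moreover have "G \<subseteq> V \<inter> L" using FG(2,4) \<open>d \<notin> G\<close> by (auto simp: V_def)
    ultimately show ?thesis by blast
  qed
  ultimately show ?thesis using s by blast
qed

lemma splits_exist:
  assumes "x \<in> \<gamma>" "y \<in> \<gamma>" "x \<noteq> y" and comp: "compatible L x y (\<gamma> - {x, y})"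
    and FG: "F \<subseteq> \<alpha>" "G \<subseteq> \<beta>" "F \<inter> G = {}" "F \<union> G = L \<inter> (\<gamma> - {x, y})"
    and card: "card F \<le> card \<alpha> - 2" "card G \<le> card \<beta> - 2"
  shows "\<exists>U V. splits x y U V \<and> U \<inter> L = F \<and> V \<inter> L = G"
  using assms(1,2)
proof (cases rule: location_cases)
  case 1
  then show ?thesis using splits_exist_same_side assms by blast
next
  case 2
  have "\<exists>V U. chord_split.splits \<gamma> \<beta> \<alpha> x y V U \<and> V \<inter> L = G \<and> U \<inter> L = F"
    using chord_split.splits_exist_same_side[OF swap 2 assms(3) comp FG(2,1) _ _ card(1)] FG
    by (simp add: Int_commute Un_commute)
  then show ?thesis using chord_split.splits_swap[OF swap] by blast
next
  case 3
  then show ?thesis using splits_exist_cross comp FG by blast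
next
  case 4
  then show ?thesis
    using splits_exist_cross[of y x L F G] comp FG splits_commute compatible_commute
    by (simp add: insert_commute)
qed

end

subsection \<open>Walks and refinement\<close>

definition partial_walk :: "nat set set \<Rightarrow> nat set \<Rightarrow> (nat \<Rightarrow> nat set) \<Rightarrow> bool" where
  "partial_walk P S f \<longleftrightarrow> (\<forall>k\<in>S. f k \<in> P \<and> k \<in> f k) \<and>
     (\<forall>\<alpha>\<in>P. card {k \<in> S. f k = \<alpha>} \<le> card \<alpha> - 2)"

definition exact_walk :: "nat set set \<Rightarrow> nat set \<Rightarrow> (nat \<Rightarrow> nat set) \<Rightarrow> bool" where
  "exact_walk P S f \<longleftrightarrow> (\<forall>k\<in>S. f k \<in> P \<and> k \<in> f k) \<and>
     (\<forall>\<alpha>\<in>P. card {k \<in> S. f k = \<alpha>} = card \<alpha> - 2)"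

text \<open>Below, \<open>W\<close> consists of all vertices other than \<open>i\<close> and \<open>j\<close>, and \<open>L\<close> of those from \<open>i\<close> to \<open>j\<close>.\<close>

definition uniquely_extendable :: "nat set set \<Rightarrow> nat set \<Rightarrow> nat set \<Rightarrow> bool" where
  "uniquely_extendable P W L \<longleftrightarrow>
     (\<forall>f. partial_walk P L f \<longrightarrow> (\<exists>g. exact_walk P W g \<and> (\<forall>k\<in>L. g k = f k))) \<and>
     (\<forall>g h. exact_walk P W g \<and> exact_walk P W h \<and> (\<forall>k\<in>L. g k = h k) \<longrightarrow> (\<forall>k\<in>W. g k = h k))"

text \<open>The pair \<open>x\<close>, \<open>y\<close> is what the fiber of \<open>\<alpha>\<close>
  leaves over, hence determined up to order; quantifying over all such pairs avoids a
  choice.\<close>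

definition separating :: "nat set set \<Rightarrow> nat set \<Rightarrow> nat set \<Rightarrow> bool" where
  "separating P W L \<longleftrightarrow> (\<forall>g \<alpha> x y. exact_walk P W g \<and> \<alpha> \<in> P \<and> x \<in> \<alpha> \<and> y \<in> \<alpha> \<and> x \<noteq> y \<and>
     {k \<in> W. g k = \<alpha>} = \<alpha> - {x, y} \<longrightarrow> compatible L x y (\<alpha> - {x, y}))"

lemma exact_walk_missing:
  assumes "exact_walk P W g" "\<alpha> \<in> P" "2 \<le> card \<alpha>"
  obtains x y where "x \<in> \<alpha>" "y \<in> \<alpha>" "x \<noteq> y" "{k \<in> W. g k = \<alpha>} = \<alpha> - {x, y}"
proof -
  let ?U = "{k \<in> W. g k = \<alpha>}"
  have U: "?U \<subseteq> \<alpha>" "card ?U = card \<alpha> - 2"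
    using assms by (auto simp: exact_walk_def)
  have "finite \<alpha>" using assms(3) by (intro card_ge_0_finite) simp
  then have "card (\<alpha> - ?U) = 2"
    using U assms(3) finite_subset[OF U(1)] by (subst card_Diff_subset) auto
  then obtain x y where "\<alpha> - ?U = {x, y}" "x \<noteq> y" by (auto simp: card_2_iff)
  then show ?thesis using that[of x y] U(1) by blast
qed

text \<open>Adding one diagonal, in abstract form: \<open>P\<close> is the current family of pieces.
  That \<open>\<alpha>\<close> and \<open>\<beta>\<close> are new keeps their fibers apart from
  those of the old pieces; the bound on \<open>card \<alpha>\<close> gives
  \<open>\<alpha> \<noteq> \<beta>\<close>.\<close>

locale piece_split = chord_split +
  fixes P :: "nat set set" and W L :: "nat set"
  assumes piece: "\<gamma> \<in> P" and new: "\<alpha> \<notin> P" "\<beta> \<notin> P"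
    and card3: "3 \<le> card \<alpha>" and fin_W: "finite W" and L_sub: "L \<subseteq> W"
begin

section \<open>Merging the two new pieces back into the old one\<close>

definition refined :: "nat set set" where
  "refined = insert \<alpha> (insert \<beta> (P - {\<gamma>}))"

definition merge :: "(nat \<Rightarrow> nat set) \<Rightarrow> nat \<Rightarrow> nat set" where
  "merge g k = (if g k = \<alpha> \<or> g k = \<beta> then \<gamma> else g k)"

lemma ne: "\<alpha> \<noteq> \<beta>" "\<alpha> \<noteq> \<gamma>" "\<beta> \<noteq> \<gamma>"
proof -
  have "card {a, b} = 2" using distinct by simp
  then show "\<alpha> \<noteq> \<beta>" using inter card3 by auto
qed (use piece new in auto)

lemma fiber_merge:
  assumes "\<forall>k\<in>S. g k \<in> refined"
  shows "{k \<in> S. merge g k = \<gamma>} = {k \<in> S. g k = \<alpha>} \<union> {k \<in> S. g k = \<beta>}"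
    and "\<delta> \<in> P - {\<gamma>} \<Longrightarrow> {k \<in> S. merge g k = \<delta>} = {k \<in> S. g k = \<delta>}"
  using assms ne new by (auto simp: merge_def refined_def)

lemma card_fiber_merge:
  assumes "\<forall>k\<in>S. g k \<in> refined" "finite S"
  shows "card {k \<in> S. merge g k = \<gamma>} = card {k \<in> S. g k = \<alpha>} + card {k \<in> S. g k = \<beta>}"
  unfolding fiber_merge(1)[OF assms(1)]
  using assms(2) ne by (intro card_Un_disjoint) auto

lemma merge_incident:
  assumes "\<forall>k\<in>S. g k \<in> refined \<and> k \<in> g k"
  shows "\<forall>k\<in>S. merge g k \<in> P \<and> k \<in> merge g k"
  using assms piece union by (auto simp: merge_def refined_def)

text \<open>The sides share exactly \<open>a\<close> and \<open>b\<close>, so the capacities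
  \<open>card \<alpha> - 2\<close> and \<open>card \<beta> - 2\<close> add up to
  \<open>card \<gamma> - 2\<close>.\<close>

lemma partial_walk_merge:
  assumes "partial_walk refined S g" "finite S"
  shows "partial_walk P S (merge g)"
proof -
  have inc: "\<forall>k\<in>S. g k \<in> refined \<and> k \<in> g k" using assms by (simp add: partial_walk_def)
  then have r: "\<forall>k\<in>S. g k \<in> refined" by simp
  have "card {k \<in> S. merge g k = \<delta>} \<le> card \<delta> - 2" if "\<delta> \<in> P" for \<delta>
  proof (cases "\<delta> = \<gamma>")
    case True
    have "card {k \<in> S. g k = \<alpha>} \<le> card \<alpha> - 2" "card {k \<in> S. g k = \<beta>} \<le> card \<beta> - 2"
      using assms by (auto simp: partial_walk_def refined_def)
    then show ?thesis using card_fiber_merge[OF r assms(2)] card_sides True by simp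
  next
    case False
    then show ?thesis
      using fiber_merge(2)[OF r, of \<delta>] that assms by (simp add: partial_walk_def refined_def)
  qed
  then show ?thesis using merge_incident[OF inc] by (simp add: partial_walk_def)
qed

lemma exact_walk_merge:
  assumes "exact_walk refined S g" "finite S"
  shows "exact_walk P S (merge g)"
proof -
  have inc: "\<forall>k\<in>S. g k \<in> refined \<and> k \<in> g k" using assms by (simp add: exact_walk_def)
  then have r: "\<forall>k\<in>S. g k \<in> refined" by simp
  have "card {k \<in> S. merge g k = \<delta>} = card \<delta> - 2" if "\<delta> \<in> P" for \<delta>
  proof (cases "\<delta> = \<gamma>")
    case True
    have "card {k \<in> S. g k = \<alpha>} = card \<alpha> - 2" "card {k \<in> S. g k = \<beta>} = card \<beta> - 2"
      using assms by (auto simp: exact_walk_def refined_def)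
    then show ?thesis using card_fiber_merge[OF r assms(2)] card_sides True by simp
  next
    case False
    then show ?thesis
      using fiber_merge(2)[OF r, of \<delta>] that assms by (simp add: exact_walk_def refined_def)
  qed
  then show ?thesis using merge_incident[OF inc] by (simp add: exact_walk_def)
qed

lemma card_piece: "2 \<le> card \<gamma>"
  using card_sides by simp

lemma splits_fibers:
  assumes "exact_walk refined W g" "{k \<in> W. merge g k = \<gamma>} = \<gamma> - {x, y}"
  shows "splits x y {k \<in> W. g k = \<alpha>} {k \<in> W. g k = \<beta>}"
proof -
  have r: "\<forall>k\<in>W. g k \<in> refined" using assms by (simp add: exact_walk_def)
  have "{k \<in> W. g k = \<alpha>} \<union> {k \<in> W. g k = \<beta>} = \<gamma> - {x, y}"
    using fiber_merge(1)[OF r] assms(2) by simp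
  moreover have "{k \<in> W. g k = \<alpha>} \<subseteq> \<alpha>" "{k \<in> W. g k = \<beta>} \<subseteq> \<beta>"
    "card {k \<in> W. g k = \<alpha>} = card \<alpha> - 2" "card {k \<in> W. g k = \<beta>} = card \<beta> - 2"
    using assms by (auto simp: exact_walk_def refined_def)
  ultimately show ?thesis using ne unfolding splits_def by auto
qed

text \<open>The merged walk extends to \<open>g\<close> over the old pieces; then the fiber of
  \<open>\<gamma>\<close> under \<open>g\<close> is distributed in a way that respects
  \<open>f\<close> on \<open>L\<close>.\<close>

lemma extension_refined:
  assumes ext: "uniquely_extendable P W L" and sepa: "separating P W L"
    and f: "partial_walk refined L f"
  shows "\<exists>g. exact_walk refined W g \<and> (\<forall>k\<in>L. g k = f k)"
proof -
  have "finite L" using L_sub fin_W finite_subset by blast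
  then have "partial_walk P L (merge f)" using partial_walk_merge f by blast
  then obtain g where g: "exact_walk P W g" "\<forall>k\<in>L. g k = merge f k"
    using ext by (auto simp: uniquely_extendable_def)
  obtain x y where xy: "x \<in> \<gamma>" "y \<in> \<gamma>" "x \<noteq> y" "{k \<in> W. g k = \<gamma>} = \<gamma> - {x, y}"
    using exact_walk_missing[OF g(1) piece card_piece] .
  have comp: "compatible L x y (\<gamma> - {x, y})"
    using sepa g(1) piece xy by (auto simp: separating_def)
  define F G where "F = {k \<in> L. f k = \<alpha>}" and "G = {k \<in> L. f k = \<beta>}"
  have r: "\<forall>k\<in>L. f k \<in> refined" using f by (simp add: partial_walk_def)
  have "F \<union> G = {k \<in> L. merge f k = \<gamma>}" using fiber_merge(1)[OF r] by (simp add: F_def G_def)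
  also have "\<dots> = L \<inter> {k \<in> W. g k = \<gamma>}" using g(2) L_sub by auto
  finally have FG: "F \<union> G = L \<inter> (\<gamma> - {x, y})" using xy(4) by simp
  have "F \<subseteq> \<alpha>" "G \<subseteq> \<beta>" "F \<inter> G = {}" "card F \<le> card \<alpha> - 2" "card G \<le> card \<beta> - 2"
    using f ne by (auto simp: F_def G_def partial_walk_def refined_def)
  then obtain U V where UV: "splits x y U V" "U \<inter> L = F" "V \<inter> L = G"
    using splits_exist[OF xy(1-3) comp _ _ _ FG] by auto
  then have s: "U \<subseteq> \<alpha>" "V \<subseteq> \<beta>" "U \<inter> V = {}" "U \<union> V = {k \<in> W. g k = \<gamma>}"
    "card U = card \<alpha> - 2" "card V = card \<beta> - 2"
    using xy(4) by (auto simp: splits_def)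
  define h where "h k = (if k \<in> U then \<alpha> else if k \<in> V then \<beta> else g k)" for k
  have hU: "h k = \<alpha>" if "k \<in> U" for k using that by (simp add: h_def)
  have hV: "h k = \<beta>" if "k \<in> V" for k using that s(3) by (auto simp: h_def)
  have hg: "h k = g k" "g k \<in> P - {\<gamma>}" "k \<in> g k" if "k \<in> W" "k \<notin> U" "k \<notin> V" for k
    using that s(4) g(1) by (auto simp: h_def exact_walk_def)
  have sub: "U \<subseteq> W" "V \<subseteq> W" using s(4) by auto
  have mem: "(h k = \<alpha>) = (k \<in> U)" "(h k = \<beta>) = (k \<in> V)" if "k \<in> W" for k
    using that hU[of k] hV[of k] hg[of k] new ne(1) s(3)
    by (cases "k \<in> U"; cases "k \<in> V"; auto)+
  have "{k \<in> W. h k = \<alpha>} = U" using mem(1) sub(1) by blast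
  moreover have "{k \<in> W. h k = \<beta>} = V" using mem(2) sub(2) by blast
  moreover have "{k \<in> W. h k = \<delta>} = {k \<in> W. g k = \<delta>}" if "\<delta> \<in> P - {\<gamma>}" for \<delta>
  proof -
    have "h k = \<delta> \<longleftrightarrow> g k = \<delta>" if "k \<in> W" for k
    proof (cases "k \<in> U \<union> V")
      case True
      then have "g k = \<gamma>" "h k = \<alpha> \<or> h k = \<beta>" using s(4) hU hV by auto
      then show ?thesis using \<open>\<delta> \<in> P - {\<gamma>}\<close> new by auto
    next
      case False
      then show ?thesis using hg that by auto
    qed
    then show ?thesis by blast
  qed
  moreover have "h k \<in> refined \<and> k \<in> h k" if "k \<in> W" for k
  proof -
    consider "k \<in> U" | "k \<in> V" | "k \<notin> U" "k \<notin> V" by blast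
    then show ?thesis
      using hU[of k] hV[of k] hg[OF that] s(1,2) by cases (auto simp: refined_def)
  qed
  ultimately have "exact_walk refined W h"
    using s g(1) by (auto simp: exact_walk_def refined_def)
  moreover have "h k = f k" if "k \<in> L" for k
  proof -
    consider "k \<in> U" | "k \<in> V" | "k \<notin> U" "k \<notin> V" by blast
    then show ?thesis
    proof cases
      case 1
      then show ?thesis using UV(2) hU that by (auto simp: F_def)
    next
      case 2
      then show ?thesis using UV(3) hV that by (auto simp: G_def)
    next
      case 3
      then have "k \<notin> F" "k \<notin> G" using UV by auto
      then have "merge f k = f k" using that by (auto simp: merge_def F_def G_def)
      then show ?thesis using 3 g(2) that by (simp add: h_def)
    qed
  qed
  ultimately show ?thesis by blast
qed

text \<open>After merging, the walks agree by the old uniqueness, so they have the same fiber over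
  \<open>\<gamma>\<close> and the same missing pair. Then \<open>splits_unique\<close> identifies
  the fibers of \<open>\<alpha>\<close>.\<close>

lemma uniqueness_refined:
  assumes ext: "uniquely_extendable P W L" and sepa: "separating P W L"
    and g: "exact_walk refined W g" and h: "exact_walk refined W h"
    and agree: "\<forall>k\<in>L. g k = h k"
  shows "\<forall>k\<in>W. g k = h k"
proof -
  have m: "exact_walk P W (merge g)" "exact_walk P W (merge h)"
    using exact_walk_merge g h fin_W by auto
  moreover have "\<forall>k\<in>L. merge g k = merge h k" using agree by (simp add: merge_def)
  ultimately have eq: "\<forall>k\<in>W. merge g k = merge h k"
    using ext unfolding uniquely_extendable_def by blast
  obtain x y where xy: "x \<in> \<gamma>" "y \<in> \<gamma>" "x \<noteq> y" "{k \<in> W. merge g k = \<gamma>} = \<gamma> - {x, y}"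
    using exact_walk_missing[OF m(1) piece card_piece] .
  then have xy': "{k \<in> W. merge h k = \<gamma>} = \<gamma> - {x, y}" using eq by auto
  have comp: "compatible L x y (\<gamma> - {x, y})"
    using sepa m(1) piece xy by (auto simp: separating_def)
  have "{k \<in> W. g k = \<alpha>} = {k \<in> W. h k = \<alpha>}"
    using splits_unique[OF xy(1-3) comp splits_fibers[OF g xy(4)] splits_fibers[OF h xy']] agree
    by auto
  then have "g k = \<alpha> \<longleftrightarrow> h k = \<alpha>" if "k \<in> W" for k using that by auto
  \<comment> \<open>As \<open>\<gamma>\<close> is not a refined piece, the merged value
    \<open>\<gamma>\<close> can only stem from \<open>\<alpha>\<close> or
    \<open>\<beta>\<close>.\<close>
  moreover have "g k \<noteq> \<gamma>" "h k \<noteq> \<gamma>" if "k \<in> W" for k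
    using g h that ne by (auto simp: exact_walk_def refined_def)
  ultimately show ?thesis using eq unfolding merge_def by metis
qed

lemma separating_fiber:
  assumes sepa: "separating P W L" and g: "exact_walk refined W g"
    and x': "x' \<in> \<alpha>" "y' \<in> \<alpha>" "x' \<noteq> y'" "{k \<in> W. g k = \<alpha>} = \<alpha> - {x', y'}"
  shows "compatible L x' y' (\<alpha> - {x', y'})"
proof -
  have m: "exact_walk P W (merge g)" using exact_walk_merge g fin_W by auto
  obtain x y where xy: "x \<in> \<gamma>" "y \<in> \<gamma>" "x \<noteq> y" "{k \<in> W. merge g k = \<gamma>} = \<gamma> - {x, y}"
    using exact_walk_missing[OF m(1) piece card_piece] .
  have comp: "compatible L x y (\<gamma> - {x, y})"
    using sepa m(1) piece xy by (auto simp: separating_def)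
  show ?thesis
    using splits_compatible[OF xy(1-3) comp splits_fibers[OF g xy(4)] x'(4,1-3)] x'(4) by simp
qed

end

lemma (in piece_split) swap_piece:
  assumes "3 \<le> card \<beta>"
  shows "piece_split \<gamma> \<beta> \<alpha> a b P W L"
  by (intro piece_split.intro piece_split_axioms.intro swap piece new assms fin_W L_sub)

lemma (in piece_split) refine:
  assumes "uniquely_extendable P W L" "separating P W L" "3 \<le> card \<beta>"
  shows "uniquely_extendable refined W L" "separating refined W L"
proof -
  show "uniquely_extendable refined W L"
    unfolding uniquely_extendable_def[of refined]
    using extension_refined[OF assms(1,2)] uniqueness_refined[OF assms(1,2)] by blast
  \<comment> \<open>\<open>separating_fiber\<close> treats \<open>\<alpha>\<close>; the exchanged
    instance supplies \<open>\<beta>\<close>.\<close>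
  interpret sw: piece_split \<gamma> \<beta> \<alpha> a b P W L using swap_piece assms(3) .
  have "sw.refined = refined" by (auto simp: refined_def sw.refined_def)
  note sw = sw.separating_fiber[unfolded this]
  show "separating refined W L"
    unfolding separating_def
  proof (intro allI impI, elim conjE)
    fix g \<delta> x y
    assume g: "exact_walk refined W g" and \<delta>: "\<delta> \<in> refined"
      and xy: "x \<in> \<delta>" "y \<in> \<delta>" "x \<noteq> y" "{k \<in> W. g k = \<delta>} = \<delta> - {x, y}"
    consider "\<delta> = \<alpha>" | "\<delta> = \<beta>" | "\<delta> \<in> P - {\<gamma>}" using \<delta> by (auto simp: refined_def)
    then show "compatible L x y (\<delta> - {x, y})"
    proof cases
      case 1
      then show ?thesis using separating_fiber[OF assms(2) g] xy by blast
    next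
      case 2
      then show ?thesis using sw[OF assms(2) g] xy by blast
    next
      case 3
      have "\<forall>k\<in>W. g k \<in> refined" using g by (simp add: exact_walk_def)
      then have "{k \<in> W. merge g k = \<delta>} = \<delta> - {x, y}" using fiber_merge(2) 3 xy(4) by simp
      then show ?thesis
        using assms(2) exact_walk_merge[OF g fin_W] 3 xy by (auto simp: separating_def)
    qed
  qed
qed

subsection \<open>Inserting a diagonal into a dissection\<close>


text \<open>The intersection of sides from which \<open>pieces\<close> is built, kept also for
  choices \<open>A\<close> that leave fewer than three vertices.\<close>

definition cell :: "nat \<Rightarrow> (nat \<times> nat) set \<Rightarrow> (nat \<times> nat) set \<Rightarrow> nat set" where
  "cell n D A = {v \<in> {1..n}. (\<forall>(a, b)\<in>A. v \<in> {a..b}) \<and> (\<forall>(a, b)\<in>D - A. v \<in> {1..a} \<union> {b..n})}"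

lemma pieces_cell: "pieces n D = {cell n D A | A. A \<subseteq> D \<and> 3 \<le> card (cell n D A)}"
  unfolding pieces_def cell_def by blast

lemma piece_cases:
  assumes "\<gamma> \<in> pieces n D"
  obtains A where "A \<subseteq> D" "\<gamma> = cell n D A" "3 \<le> card (cell n D A)"
  using assms by (auto simp: pieces_cell)

lemma cell_insert:
  assumes "A \<subseteq> D" "(a, b) \<notin> D"
  shows "cell n (insert (a, b) D) (insert (a, b) A) = cell n D A \<inter> {a..b}"
    and "cell n (insert (a, b) D) A = cell n D A \<inter> ({..a} \<union> {b..})"
proof -
  have "insert (a, b) D - insert (a, b) A = D - A" "insert (a, b) D - A = insert (a, b) (D - A)"
    using assms by auto
  then show "cell n (insert (a, b) D) (insert (a, b) A) = cell n D A \<inter> {a..b}"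
    "cell n (insert (a, b) D) A = cell n D A \<inter> ({..a} \<union> {b..})"
    unfolding cell_def by auto
qed

lemma finite_cell: "finite (cell n D A)"
  by (simp add: cell_def)

text \<open>Distinct pieces come from distinct choices of sides, and a diagonal on which the choices
  differ has the pieces on opposite sides.\<close>

lemma pieces_separated:
  assumes "\<gamma> \<in> pieces n D" "\<delta> \<in> pieces n D" "\<gamma> \<noteq> \<delta>"
  obtains c d where "(c, d) \<in> D" "\<gamma> \<subseteq> {c..d} \<and> \<delta> \<subseteq> {..c} \<union> {d..} \<or> \<delta> \<subseteq> {c..d} \<and> \<gamma> \<subseteq> {..c} \<union> {d..}"
proof -
  from assms(1) obtain A where A: "A \<subseteq> D" "\<gamma> = cell n D A" by (rule piece_cases)
  from assms(2) obtain B where B: "B \<subseteq> D" "\<delta> = cell n D B" by (rule piece_cases)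
  have "A \<noteq> B" using assms A B by auto
  then obtain c d where cd: "(c, d) \<in> A - B \<or> (c, d) \<in> B - A" by auto
  have "(c, d) \<in> D" using cd A B by auto
  moreover have "\<gamma> \<subseteq> {c..d} \<and> \<delta> \<subseteq> {..c} \<union> {d..} \<or> \<delta> \<subseteq> {c..d} \<and> \<gamma> \<subseteq> {..c} \<union> {d..}"
    using cd
  proof
    assume "(c, d) \<in> A - B"
    then have "\<gamma> \<subseteq> {c..d}" "\<delta> \<subseteq> {..c} \<union> {d..}" using A B by (fastforce simp: cell_def)+
    then show ?thesis by blast
  next
    assume "(c, d) \<in> B - A"
    then have "\<delta> \<subseteq> {c..d}" "\<gamma> \<subseteq> {..c} \<union> {d..}" using A B by (fastforce simp: cell_def)+
    then show ?thesis by blast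
  qed
  ultimately show ?thesis using that by blast
qed

text \<open>Opposite sides of a diagonal share only its ends. This will show that the halves of a
  cut piece were not pieces before.\<close>

lemma card_pieces_inter:
  assumes "\<gamma> \<in> pieces n D" "\<delta> \<in> pieces n D" "\<gamma> \<noteq> \<delta>"
  shows "card (\<gamma> \<inter> \<delta>) \<le> 2"
proof -
  obtain c d where "\<gamma> \<subseteq> {c..d} \<and> \<delta> \<subseteq> {..c} \<union> {d..} \<or> \<delta> \<subseteq> {c..d} \<and> \<gamma> \<subseteq> {..c} \<union> {d..}"
    using assms by (rule pieces_separated)
  then have "\<gamma> \<inter> \<delta> \<subseteq> {c, d}" by fastforce
  then have "card (\<gamma> \<inter> \<delta>) \<le> card {c, d}" by (intro card_mono) auto
  then show ?thesis using card_insert_le_m1[of 2 "{d}" c] by (simp add: card_insert_if split: if_splits)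
qed

lemma card_ge_3:
  assumes "{x, y, z} \<subseteq> S" "x < y" "y < (z :: nat)" "finite S"
  shows "3 \<le> card S"
proof -
  have "card {x, y, z} = 3" using assms(2,3) by simp
  then show ?thesis using card_mono[OF assms(4,1)] by simp
qed

text \<open>The vertex \<open>u\<close> is the farthest neighbour of \<open>a\<close> before \<open>b\<close>; the vertex \<open>v\<close> is an end point of
  the shortest diagonal, or side \<open>(1, n)\<close>, that encloses \<open>(a, b)\<close>.\<close>

lemma cell_of_diagonal:
  assumes dis: "dissection n (insert (a, b) D)" and new: "(a, b) \<notin> D"
  obtains A u v where "A \<subseteq> D" "a \<in> cell n D A" "b \<in> cell n D A"
    "u \<in> cell n D A" "a < u" "u < b" "v \<in> cell n D A" "v < a \<or> b < v"
proof -
  have ab: "1 \<le> a" "a + 1 < b" "b \<le> n" "(a, b) \<noteq> (1, n)"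
    using dis by (auto simp: dissection_def diagonals_def)
  have diag: "1 \<le> c" "c + 1 < d" "d \<le> n" "(c, d) \<noteq> (1, n)" if "(c, d) \<in> D" for c d
    using dis that by (auto simp: dissection_def diagonals_def)
  have nc: "\<not> (c < c' \<and> c' < d \<and> d < d')" if "(c, d) \<in> insert (a, b) D" "(c', d') \<in> insert (a, b) D"
    for c d c' d'
  proof -
    have "\<not> crossing (c, d) (c', d')" using dis that unfolding dissection_def by blast
    then show ?thesis by (simp add: crossing_def)
  qed
  \<comment> \<open>The choice is forced: \<open>{c..d}\<close> contains both \<open>a\<close> and
    \<open>b\<close> just for these diagonals, and their outer sides miss \<open>a\<close> or
    \<open>b\<close> because \<open>(c, d)\<close> is not \<open>(a, b)\<close>.\<close>
  define A where "A = {(c, d) \<in> D. c \<le> a \<and> b \<le> d}"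
  have mem: "w \<in> cell n D A"
    if "1 \<le> w" "w \<le> n" "\<And>c d. (c, d) \<in> D \<Longrightarrow> c \<le> a \<Longrightarrow> b \<le> d \<Longrightarrow> c \<le> w \<and> w \<le> d"
      "\<And>c d. (c, d) \<in> D \<Longrightarrow> \<not> (c \<le> a \<and> b \<le> d) \<Longrightarrow> w \<le> c \<or> d \<le> w" for w
    using that by (auto simp: cell_def A_def)
  have not_enclosing: "d \<le> a \<or> b \<le> c \<or> a \<le> c \<and> d \<le> b"
    if "(c, d) \<in> D" "\<not> (c \<le> a \<and> b \<le> d)" for c d
    using nc[of c d a b] nc[of a b c d] that ab by fastforce
  have "a \<in> cell n D A"
    using ab by (intro mem) (use not_enclosing in fastforce)+
  moreover have "b \<in> cell n D A"
    using ab by (intro mem) (use not_enclosing in fastforce)+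
  moreover obtain u where "u \<in> cell n D A" "a < u" "u < b"
  proof -
    \<comment> \<open>The entry \<open>a + 1\<close> accounts for the polygon side at
      \<open>a\<close> and keeps \<open>S\<close> nonempty.\<close>
    define S where "S = insert (a + 1) {u. (a, u) \<in> D \<and> u < b}"
    define u where "u = Max S"
    have "finite S" unfolding S_def by simp
    moreover have "S \<noteq> {}" by (simp add: S_def)
    ultimately have u: "u \<in> S" "\<And>s. s \<in> S \<Longrightarrow> s \<le> u" unfolding u_def by simp_all
    have au: "a < u" "u < b" using u(1) ab(2) diag(2)[of a u] by (auto simp: S_def)
    have "u \<in> cell n D A"
    proof (rule mem)
      fix c d assume cd: "(c, d) \<in> D" "\<not> (c \<le> a \<and> b \<le> d)"
      show "u \<le> c \<or> d \<le> u"
      proof (rule ccontr)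
        assume n: "\<not> (u \<le> c \<or> d \<le> u)"
        then have in_ab: "a \<le> c" "d \<le> b" using not_enclosing[OF cd] au by auto
        show False
        proof (cases "c = a")
          case True
          then have "d < b" using in_ab cd by auto
          then have "d \<le> u" using True cd u(2) by (simp add: S_def)
          then show False using n by simp
        next
          case False
          \<comment> \<open>Now \<open>a < c\<close> and \<open>c < u\<close>, so \<open>u\<close>
            is not the default \<open>a + 1\<close> but the end of a diagonal, which
            \<open>(c, d)\<close> would cross.\<close>
          then have "(a, u) \<in> D" using u(1) n in_ab by (auto simp: S_def)
          then show False using nc[of a u c d] cd n in_ab False by auto
        qed
      qed
    qed (use au ab in auto)
    then show ?thesis using that au by blast
  qed
  moreover obtain v where "v \<in> cell n D A" "v < a \<or> b < v"
  proof -
    \<comment> \<open>The side \<open>(1, n)\<close> serves as an outermost diagonal, so that a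
      shortest enclosing pair exists even if \<open>A\<close> is empty.\<close>
    define E where "E = insert (1, n) A"
    have "(1, n) \<in> E" by (simp add: E_def)
    then obtain e where "e \<in> E" "\<And>e'. e' \<in> E \<Longrightarrow> snd e - fst e \<le> snd e' - fst e'"
      using ex_has_least_nat[of "\<lambda>e. e \<in> E" _ "\<lambda>e. snd e - fst e"] by blast
    moreover obtain c d where "e = (c, d)" by force
    ultimately have cd: "(c, d) \<in> E" "\<And>x y. (x, y) \<in> E \<Longrightarrow> d - c \<le> y - x"
      by fastforce+
    have enc: "1 \<le> x" "x \<le> a" "b \<le> y" "y \<le> n" if "(x, y) \<in> E" for x y
      using that ab diag by (auto simp: E_def A_def)
    have ncE: "\<not> (x < x' \<and> x' < y \<and> y < y')" if "(x, y) \<in> insert (1, n) D" "(x', y') \<in> insert (1, n) D"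
      for x y x' y'
      using that nc[of x y x' y'] diag[of x y] diag[of x' y'] by fastforce
    have cdD: "(c, d) \<in> insert (1, n) D" using cd(1) by (auto simp: E_def A_def)
    \<comment> \<open>Noncrossing pairs that both enclose \<open>(a, b)\<close> are nested, and
      \<open>(c, d)\<close> is a shortest one.\<close>
    have nested: "x \<le> c \<and> d \<le> y" if xy: "(x, y) \<in> D" "x \<le> a" "b \<le> y" for x y
    proof -
      have "(x, y) \<in> E" using xy by (auto simp: E_def A_def)
      then have "d - c \<le> y - x" by (rule cd(2))
      then show ?thesis using ncE[of x y c d] ncE[of c d x y] cdD xy enc[OF cd(1)] ab by auto
    qed
    have noninner: "\<not> (x < w \<and> w < y)" if "(x, y) \<in> D" "\<not> (x \<le> a \<and> b \<le> y)" "w = c \<or> w = d" for x y w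
    proof -
      have "(x, y) \<in> insert (1, n) D" using that(1) by simp
      note nc = ncE[OF this cdD] ncE[OF cdD this]
      from not_enclosing[OF that(1,2)] show ?thesis
        using that(3) nc enc(2,3)[OF cd(1)] ab(2) by (elim disjE) linarith+
    qed
    have cell: "c \<in> cell n D A" "d \<in> cell n D A"
      using enc[OF cd(1)] ab by (auto intro!: mem dest: nested noninner simp: not_less)
    have "(c, d) \<noteq> (a, b)" using cd(1) new ab by (auto simp: E_def A_def)
    then have "c < a \<or> b < d" using enc[OF cd(1)] by auto
    then show ?thesis using that cell by blast
  qed
  moreover have "A \<subseteq> D" by (auto simp: A_def)
  ultimately show ?thesis using that by blast
qed

text \<open>Only \<open>\<gamma>\<close> is cut. Any other piece lies on one side of
  \<open>(a, b)\<close>: one of its halves is the piece itself, and the other is contained in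
  \<open>{a, b}\<close>, too small for a piece.\<close>

lemma pieces_insert:
  assumes dis: "dissection n (insert (a, b) D)" and new: "(a, b) \<notin> D"
  obtains \<gamma> u v where "\<gamma> \<in> pieces n D" "a \<in> \<gamma>" "b \<in> \<gamma>" "u \<in> \<gamma>" "a < u" "u < b" "v \<in> \<gamma>" "v < a \<or> b < v"
    "pieces n (insert (a, b) D) =
       insert (\<gamma> \<inter> {a..b}) (insert (\<gamma> \<inter> ({..a} \<union> {b..})) (pieces n D - {\<gamma>}))"
proof -
  obtain A u v where A: "A \<subseteq> D" "a \<in> cell n D A" "b \<in> cell n D A"
    and u: "u \<in> cell n D A" "a < u" "u < b" and v: "v \<in> cell n D A" "v < a \<or> b < v"
    using cell_of_diagonal[OF assms] .
  define \<gamma> where "\<gamma> = cell n D A"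
  let ?D = "insert (a, b) D" and ?out = "{..a} \<union> {b..}"
  have fg: "finite \<gamma>" by (simp add: \<gamma>_def finite_cell)
  have "3 \<le> card \<gamma>" by (rule card_ge_3[of a u b]) (use A u fg in \<open>auto simp: \<gamma>_def\<close>)
  then have piece: "\<gamma> \<in> pieces n D" using A(1) by (auto simp: pieces_cell \<gamma>_def)
  have c_in: "3 \<le> card (\<gamma> \<inter> {a..b})"
    by (rule card_ge_3[of a u b]) (use A u fg in \<open>auto simp: \<gamma>_def\<close>)
  have c_out: "3 \<le> card (\<gamma> \<inter> ?out)"
    using v(2)
  proof
    assume "v < a"
    then show ?thesis
      by (intro card_ge_3[of v a b]) (use A u v fg in \<open>auto simp: \<gamma>_def\<close>)
  next
    assume "b < v"
    then show ?thesis
      by (intro card_ge_3[of a b v]) (use A u v fg in \<open>auto simp: \<gamma>_def\<close>)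
  qed
  \<comment> \<open>Some diagonal \<open>(c, d)\<close> separates \<open>\<delta>\<close> from
    \<open>\<gamma>\<close>. If \<open>\<gamma>\<close> is inside, \<open>{c..d}\<close> contains
    \<open>{a..b}\<close>, so \<open>p\<close> cannot be outside. If \<open>\<delta>\<close> is
    inside, \<open>p\<close> forces \<open>{c..d}\<close> into \<open>{a..b}\<close>, so
    \<open>q\<close> cannot be inside.\<close>
  have side: "\<delta> \<subseteq> {a..b} \<or> \<delta> \<subseteq> ?out" if \<delta>: "\<delta> \<in> pieces n D" "\<delta> \<noteq> \<gamma>" for \<delta>
  proof (rule ccontr)
    assume "\<not> ?thesis"
    then obtain p q where p: "p \<in> \<delta>" "a < p" "p < b" and q: "q \<in> \<delta>" "q < a \<or> b < q"
      by (auto simp: subset_iff not_le)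
    from piece \<delta> obtain c d where
      "\<gamma> \<subseteq> {c..d} \<and> \<delta> \<subseteq> {..c} \<union> {d..} \<or> \<delta> \<subseteq> {c..d} \<and> \<gamma> \<subseteq> {..c} \<union> {d..}"
      by (metis pieces_separated)
    then show False
    proof
      assume "\<gamma> \<subseteq> {c..d} \<and> \<delta> \<subseteq> {..c} \<union> {d..}"
      then have "a \<in> {c..d}" "b \<in> {c..d}" "p \<in> {..c} \<union> {d..}"
        using A p by (auto simp: \<gamma>_def)
      then show False using p by auto
    next
      assume "\<delta> \<subseteq> {c..d} \<and> \<gamma> \<subseteq> {..c} \<union> {d..}"
      then have "p \<in> {c..d}" "q \<in> {c..d}" "a \<in> {..c} \<union> {d..}" "b \<in> {..c} \<union> {d..}"
        using A p q by (auto simp: \<gamma>_def)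
      then show False using p q by auto
    qed
  qed
  have small: "card S \<le> 2" if "S \<subseteq> {a, b}" for S
    using card_mono[OF _ that] card_insert_le_m1[of 2 "{b}" a] by simp
  have "pieces n ?D = insert (\<gamma> \<inter> {a..b}) (insert (\<gamma> \<inter> ?out) (pieces n D - {\<gamma>}))" (is "_ = ?R")
  proof
    show "pieces n ?D \<subseteq> ?R"
    proof
      fix \<delta> assume "\<delta> \<in> pieces n ?D"
      then obtain A' where A': "A' \<subseteq> ?D" "\<delta> = cell n ?D A'" "3 \<le> card \<delta>"
        by (metis piece_cases)
      define c where "c = cell n D (A' - {(a, b)})"
      have sub: "A' - {(a, b)} \<subseteq> D" using A' by auto
      have \<delta>: "\<delta> = c \<inter> {a..b} \<or> \<delta> = c \<inter> ?out"
      proof (cases "(a, b) \<in> A'")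
        case True
        then have "insert (a, b) (A' - {(a, b)}) = A'" by auto
        then show ?thesis using cell_insert(1)[OF sub new] A' by (simp add: c_def)
      next
        case False
        then show ?thesis using cell_insert(2)[OF sub new] A' by (simp add: c_def)
      qed
      then have "\<delta> \<subseteq> c" by auto
      then have "3 \<le> card c" using A'(3) card_mono[of c \<delta>] finite_cell[of n D] by (simp add: c_def)
      then have c: "c \<in> pieces n D" using sub by (auto simp: pieces_cell c_def)
      show "\<delta> \<in> ?R"
      proof (cases "c = \<gamma>")
        case True
        then show ?thesis using \<delta> by auto
      next
        case False
        have "\<not> \<delta> \<subseteq> {a, b}" using small[of \<delta>] A'(3) by auto
        moreover have "{a..b} \<inter> ?out \<subseteq> {a, b}" by auto
        ultimately have "\<delta> = c" using \<delta> side[OF c False] by blast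
        then show ?thesis using c False by simp
      qed
    qed
    show "?R \<subseteq> pieces n ?D"
    proof
      fix \<delta> assume "\<delta> \<in> ?R"
      then obtain B where B: "B \<subseteq> D" "\<delta> = cell n D B \<inter> {a..b} \<or> \<delta> = cell n D B \<inter> ?out" "3 \<le> card \<delta>"
      proof (elim insertE)
        assume "\<delta> = \<gamma> \<inter> {a..b}"
        then show ?thesis using that[of A] A(1) c_in by (simp add: \<gamma>_def)
      next
        assume "\<delta> = \<gamma> \<inter> ?out"
        then show ?thesis using that[of A] A(1) c_out by (simp add: \<gamma>_def)
      next
        assume d: "\<delta> \<in> pieces n D - {\<gamma>}"
        then have "\<delta> = \<delta> \<inter> {a..b} \<or> \<delta> = \<delta> \<inter> ?out" using side[of \<delta>] by blast
        moreover obtain B where "B \<subseteq> D" "\<delta> = cell n D B" "3 \<le> card \<delta>"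
          using d by (metis DiffD1 piece_cases)
        ultimately show ?thesis using that[of B] by simp
      qed
      then have "\<exists>A'\<subseteq>?D. \<delta> = cell n ?D A'"
        using cell_insert[OF B(1) new] by (metis insert_mono subset_insertI2)
      then show "\<delta> \<in> pieces n ?D" using B(3) by (auto simp: pieces_cell)
    qed
  qed
  then show ?thesis using that[of \<gamma> u v] piece A u v by (simp add: \<gamma>_def)
qed

lemma chord_split_pieces:
  fixes \<gamma> :: "nat set"
  assumes "a \<in> \<gamma>" "b \<in> \<gamma>" "a < b" "finite \<gamma>"
  shows "chord_split \<gamma> (\<gamma> \<inter> {a..b}) (\<gamma> \<inter> ({..a} \<union> {b..})) a b"
proof
  show "\<not> sep x y u v"
    if "x \<in> \<gamma> \<inter> {a..b}" "y \<in> \<gamma> \<inter> {a..b}" "u \<in> \<gamma> \<inter> ({..a} \<union> {b..})" "v \<in> \<gamma> \<inter> ({..a} \<union> {b..})"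
      "{x, y} \<inter> {u, v} = {}" for x y u v
  proof -
    have "(x < w) = (y < w)" if "w \<in> {..a} \<union> {b..}" "w \<noteq> x" "w \<noteq> y" for w
      using that \<open>x \<in> _\<close> \<open>y \<in> _\<close> by auto
    then show ?thesis using that by (auto simp: sep_def)
  qed
  show "sep a b x y"
    if "x \<in> \<gamma> \<inter> {a..b} - {a, b}" "y \<in> \<gamma> \<inter> ({..a} \<union> {b..}) - {a, b}" for x y
    using that assms(3) by (auto simp: sep_def)
qed (use assms in auto)

section \<open>Unique extension by induction over the diagonals\<close>

lemma pieces_empty:
  assumes "3 \<le> n"
  shows "pieces n {} = {{1..n}}"
proof -
  have "cell n {} {} = {1..n}" by (auto simp: cell_def)
  then show ?thesis using assms by (auto simp: pieces_cell)
qed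

lemma between_props:
  assumes "i \<in> {1..n}" "j \<in> {1..n}" "i \<noteq> j"
  shows "between n i j \<union> between n j i = {1..n} - {i, j}" "between n i j \<inter> between n j i = {}"
proof -
  have "between n i j \<union> between n j i = {1..n} - {i, j} \<and> between n i j \<inter> between n j i = {}"
  proof (cases "i < j")
    case True
    then show ?thesis using assms by (auto simp: between_def)
  next
    case False
    then have "j < i" using assms(3) by simp
    then show ?thesis using assms by (auto simp: between_def)
  qed
  then show "between n i j \<union> between n j i = {1..n} - {i, j}" "between n i j \<inter> between n j i = {}"
    by blast+
qed

text \<open>Both properties go through the induction together, since \<open>refine\<close> uses the
  invariant to extend walks. In the base case the whole polygon is the only piece, and its missing
  pair is \<open>i\<close>, \<open>j\<close>.\<close>

lemma walks_extend:
  assumes n: "3 \<le> n" and ij: "i \<in> {1..n}" "j \<in> {1..n}" "i \<noteq> j"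
    and fin: "finite D" and "dissection n D"
  shows "uniquely_extendable (pieces n D) ({1..n} - {i, j}) (between n i j) \<and>
    separating (pieces n D) ({1..n} - {i, j}) (between n i j)"
  using fin assms(6)
proof (induction D rule: finite_induct)
  case empty
  let ?W = "{1..n} - {i, j}" and ?L = "between n i j"
  have L: "?L \<subseteq> ?W" using between_props[OF ij] by blast
  have W: "card ?W = n - 2" using ij by (simp add: card_Diff_subset)
  have ex: "exact_walk {{1..n}} ?W (\<lambda>_. {1..n})"
    unfolding exact_walk_def using W by (simp del: Diff_iff atLeastAtMost_iff) blast
  have const: "g k = {1..n}" if "exact_walk {{1..n}} ?W g" "k \<in> ?W" for g k
    using that by (simp add: exact_walk_def)
  have "uniquely_extendable {{1..n}} ?W ?L"
    unfolding uniquely_extendable_def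
  proof (intro conjI allI impI)
    fix f assume "partial_walk {{1..n}} ?L f"
    then show "\<exists>g. exact_walk {{1..n}} ?W g \<and> (\<forall>k\<in>?L. g k = f k)"
      using ex by (intro exI[of _ "\<lambda>_. {1..n}"]) (simp add: partial_walk_def)
  next
    fix g h assume "exact_walk {{1..n}} ?W g \<and> exact_walk {{1..n}} ?W h \<and> (\<forall>k\<in>?L. g k = h k)"
    then show "\<forall>k\<in>?W. g k = h k" using const[of g] const[of h] by blast
  qed
  moreover have "compatible ?L i j ?W"
  proof -
    \<comment> \<open>The left side says that the label \<open>u\<close> lies between the smaller
      and the larger of \<open>i\<close>, \<open>j\<close>. This arc is \<open>L\<close> if
      \<open>i < j\<close> and the opposite one otherwise; comparing two vertices cancels the
      distinction.\<close>
    have "((i < u) \<noteq> (j < u)) = ((u \<in> ?L) = (i < j))" if "u \<in> ?W" for u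
    proof (cases "i < j")
      case True
      then show ?thesis using that by (auto simp: between_def)
    next
      case False
      then have "j < i" using ij by simp
      then show ?thesis using that by (auto simp: between_def)
    qed
    then show ?thesis unfolding compatible_def sep_def by blast
  qed
  then have "separating {{1..n}} ?W ?L"
    unfolding separating_def
  proof (intro allI impI, elim conjE)
    fix g \<alpha> x y
    assume "compatible ?L i j ?W" "exact_walk {{1..n}} ?W g" "\<alpha> \<in> {{1..n}}" "x \<in> \<alpha>" "y \<in> \<alpha>"
      and W': "{k \<in> ?W. g k = \<alpha>} = \<alpha> - {x, y}"
    then have \<alpha>: "\<alpha> = {1..n}" "{k \<in> ?W. g k = \<alpha>} = ?W" using const by blast+
    then have W: "\<alpha> - {x, y} = ?W" using W' by simp
    have "{x, y} = \<alpha> - (\<alpha> - {x, y})" using \<open>x \<in> \<alpha>\<close> \<open>y \<in> \<alpha>\<close> by blast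
    also have "\<dots> = {i, j}" unfolding W using \<alpha>(1) ij by blast
    finally show "compatible ?L x y (\<alpha> - {x, y})"
      unfolding W using \<open>compatible ?L i j ?W\<close> compatible_commute by (metis doubleton_eq_iff)
  qed
  ultimately show ?case by (simp add: pieces_empty[OF n])
next
  case (insert e D)
  obtain a b where e: "e = (a, b)" by force
  have dis: "dissection n (insert (a, b) D)" using insert e by simp
  then have IH: "uniquely_extendable (pieces n D) ({1..n} - {i, j}) (between n i j)"
    "separating (pieces n D) ({1..n} - {i, j}) (between n i j)"
    using insert by (auto simp: dissection_def)
  obtain \<gamma> u v where \<gamma>: "\<gamma> \<in> pieces n D" "a \<in> \<gamma>" "b \<in> \<gamma>" "u \<in> \<gamma>" "a < u" "u < b" "v \<in> \<gamma>" "v < a \<or> b < v"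
    and P: "pieces n (insert (a, b) D) =
       insert (\<gamma> \<inter> {a..b}) (insert (\<gamma> \<inter> ({..a} \<union> {b..})) (pieces n D - {\<gamma>}))"
    using pieces_insert[OF dis] insert e by metis
  let ?\<alpha> = "\<gamma> \<inter> {a..b}" and ?\<beta> = "\<gamma> \<inter> ({..a} \<union> {b..})"
  have fg: "finite \<gamma>" using \<gamma>(1) by (metis piece_cases finite_cell)
  have "?\<alpha> \<in> pieces n (insert (a, b) D)" "?\<beta> \<in> pieces n (insert (a, b) D)" using P by auto
  then have c: "3 \<le> card ?\<alpha>" "3 \<le> card ?\<beta>" by (metis piece_cases)+
  have new: "\<delta> \<notin> pieces n D" if "\<delta> \<subseteq> \<gamma>" "3 \<le> card \<delta>" "\<delta> \<noteq> \<gamma>" for \<delta>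
    using card_pieces_inter[OF \<gamma>(1), of \<delta>] that by (auto simp: Int_absorb1)
  \<comment> \<open>\<open>u\<close> and \<open>v\<close> show that both halves are proper subsets
    of \<open>\<gamma>\<close>.\<close>
  have "v \<notin> ?\<alpha>" "u \<notin> ?\<beta>" using \<gamma>(5,6,8) by auto
  then have "?\<alpha> \<noteq> \<gamma>" "?\<beta> \<noteq> \<gamma>" using \<gamma>(4,7) by metis+
  then have "?\<alpha> \<notin> pieces n D" "?\<beta> \<notin> pieces n D" using new c by auto
  then interpret piece_split \<gamma> ?\<alpha> ?\<beta> a b "pieces n D" "{1..n} - {i, j}" "between n i j"
    using \<gamma> c fg between_props[OF ij]
    by (intro piece_split.intro piece_split_axioms.intro chord_split_pieces) auto
  show ?case using refine[OF IH c(2)] by (simp add: e P refined_def)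
qed

subsection \<open>Weights\<close>


lemma walk_weight_fibers:
  assumes "p ` between n i j \<subseteq> pieces n D"
  shows "walk_weight n i j p = (\<Prod>\<alpha>\<in>pieces n D. indet \<alpha> ^ card {k \<in> between n i j. p k = \<alpha>})"
proof -
  have "walk_weight n i j p = (\<Prod>\<alpha>\<in>pieces n D. \<Prod>k\<in>{k \<in> between n i j. p k = \<alpha>}. indet (p k))"
    unfolding walk_weight_def
    by (rule prod.group[OF finite_between finite_pieces assms, symmetric])
  also have "\<dots> = (\<Prod>\<alpha>\<in>pieces n D. \<Prod>k\<in>{k \<in> between n i j. p k = \<alpha>}. indet \<alpha>)"
    by (intro prod.cong) auto
  finally show ?thesis by simp
qed

text \<open>Monomials may cancel in \<open>f + g\<close>; a common index set for \<open>f\<close>,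
  \<open>g\<close> and \<open>f + g\<close> makes additivity a termwise matter.\<close>

lemma complementing_superset:
  assumes "finite S" "Poly_Mapping.keys f \<subseteq> S"
  shows "complementing n D f = (\<Sum>t\<in>S. of_int (Poly_Mapping.lookup f t) *
    (\<Prod>\<alpha>\<in>pieces n D. indet \<alpha> ^ (card \<alpha> - 2 - Poly_Mapping.lookup t \<alpha>)))"
  unfolding complementing_def using assms
  by (intro sum.mono_neutral_left) (auto simp: in_keys_iff)

lemma complementing_zero: "complementing n D 0 = 0"
  by (simp add: complementing_def)

lemma complementing_add: "complementing n D (f + g) = complementing n D f + complementing n D g"
proof -
  let ?S = "Poly_Mapping.keys f \<union> Poly_Mapping.keys g"
  have "finite ?S" "Poly_Mapping.keys (f + g) \<subseteq> ?S" by (simp_all add: keys_add)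
  then show ?thesis
    by (simp add: complementing_superset[of ?S] lookup_add distrib_right sum.distrib)
qed

lemma complementing_sum: "complementing n D (\<Sum>x\<in>A. f x) = (\<Sum>x\<in>A. complementing n D (f x))"
  by (induction A rule: infinite_finite_induct) (simp_all add: complementing_zero complementing_add)

section \<open>Walks as restrictions of exact walks\<close>

definition full_walks :: "nat \<Rightarrow> (nat \<times> nat) set \<Rightarrow> nat \<Rightarrow> nat \<Rightarrow> (nat \<Rightarrow> nat set) set" where
  "full_walks n D i j = {g \<in> ({1..n} - {i, j}) \<rightarrow>\<^sub>E pieces n D. exact_walk (pieces n D) ({1..n} - {i, j}) g}"

text \<open>The walks in both directions are thus restrictions of the same family.\<close>

lemma full_walks_commute: "full_walks n D i j = full_walks n D j i"
  by (simp add: full_walks_def insert_commute)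

text \<open>Injectivity is the uniqueness of extensions, surjectivity their existence.\<close>

lemma bij_betw_walks:
  assumes n: "3 \<le> n" and ij: "i \<in> {1..n}" "j \<in> {1..n}" "i \<noteq> j" and dis: "dissection n D"
  shows "bij_betw (\<lambda>g. restrict g (between n i j)) (full_walks n D i j) (walks n D i j)"
proof -
  let ?W = "{1..n} - {i, j}" and ?L = "between n i j" and ?P = "pieces n D"
  have L: "?L \<subseteq> ?W" using between_props[OF ij] by blast
  have "D \<subseteq> {1..n} \<times> {1..n}" using dis by (auto simp: dissection_def diagonals_def)
  then have "finite D" by (rule finite_subset) simp
  then have ext: "uniquely_extendable ?P ?W ?L" using walks_extend[OF n ij _ dis] by blast
  have exist: "\<exists>g. exact_walk ?P ?W g \<and> (\<forall>k\<in>?L. g k = p k)" if "partial_walk ?P ?L p" for p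
    using conjunct1[OF ext[unfolded uniquely_extendable_def]] that by simp
  have unique: "\<forall>k\<in>?W. g k = h k"
    if "exact_walk ?P ?W g" "exact_walk ?P ?W h" "\<forall>k\<in>?L. g k = h k" for g h
    using conjunct2[OF ext[unfolded uniquely_extendable_def], rule_format, of g h] that by simp
  have walks: "walks n D i j = {p \<in> ?L \<rightarrow>\<^sub>E ?P. partial_walk ?P ?L p}"
    using ij(3) by (auto simp: walks_def partial_walk_def)
  show ?thesis
  proof (rule bij_betw_imageI)
    show "inj_on (\<lambda>g. restrict g ?L) (full_walks n D i j)"
    proof (rule inj_onI)
      fix g h
      assume gh: "g \<in> full_walks n D i j" "h \<in> full_walks n D i j" "restrict g ?L = restrict h ?L"
      then have "\<forall>k\<in>?L. g k = h k" by (metis restrict_apply')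
      then have eq: "\<forall>k\<in>?W. g k = h k" using unique gh by (simp add: full_walks_def)
      have "g \<in> ?W \<rightarrow>\<^sub>E ?P" "h \<in> ?W \<rightarrow>\<^sub>E ?P" using gh by (simp_all add: full_walks_def)
      then show "g = h" by (rule PiE_ext) (use eq in blast)
    qed
    show "(\<lambda>g. restrict g ?L) ` full_walks n D i j = walks n D i j"
    proof (intro equalityI subsetI)
      fix p assume "p \<in> (\<lambda>g. restrict g ?L) ` full_walks n D i j"
      then obtain g where p: "p = restrict g ?L" and g: "exact_walk ?P ?W g"
        by (auto simp: full_walks_def)
      have "card {k \<in> ?L. p k = \<alpha>} \<le> card \<alpha> - 2" if "\<alpha> \<in> ?P" for \<alpha>
      proof -
        have "card {k \<in> ?L. p k = \<alpha>} \<le> card {k \<in> ?W. g k = \<alpha>}"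
          using L by (intro card_mono) (auto simp: p)
        then show ?thesis using g that by (simp add: exact_walk_def)
      qed
      moreover have "p k \<in> ?P \<and> k \<in> p k" if "k \<in> ?L" for k
        using that L g by (auto simp: p exact_walk_def)
      ultimately show "p \<in> walks n D i j" unfolding walks partial_walk_def by (auto simp: p)
    next
      fix p assume "p \<in> walks n D i j"
      then have p: "p \<in> ?L \<rightarrow>\<^sub>E ?P" "partial_walk ?P ?L p" by (auto simp: walks)
      then obtain g where g: "exact_walk ?P ?W g" "\<forall>k\<in>?L. g k = p k"
        using exist by blast
      have eq: "{k \<in> ?W. restrict g ?W k = \<alpha>} = {k \<in> ?W. g k = \<alpha>}" for \<alpha>
        by (rule Collect_cong) (metis restrict_apply')
      have "exact_walk ?P ?W (restrict g ?W)"
        using g(1) unfolding exact_walk_def eq by (simp del: Diff_iff)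
      moreover from this have "restrict g ?W \<in> ?W \<rightarrow>\<^sub>E ?P"
        by (auto simp: exact_walk_def simp del: Diff_iff)
      ultimately have "restrict g ?W \<in> full_walks n D i j" by (simp add: full_walks_def)
      moreover have "p = restrict (restrict g ?W) ?L"
        using p(1) g(2) L by (intro PiE_ext[of p ?L "\<lambda>_. ?P"]) (auto simp: subset_iff)
      ultimately show "p \<in> (\<lambda>g. restrict g ?L) ` full_walks n D i j" by blast
    qed
  qed
qed

lemma weight_full_walks:
  assumes "3 \<le> n" "i \<in> {1..n}" "j \<in> {1..n}" "i \<noteq> j" "dissection n D"
  shows "weight n D i j =
    (\<Sum>g\<in>full_walks n D i j. \<Prod>\<alpha>\<in>pieces n D. indet \<alpha> ^ card {k \<in> between n i j. g k = \<alpha>})"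
proof -
  have "weight n D i j = (\<Sum>g\<in>full_walks n D i j. walk_weight n i j (restrict g (between n i j)))"
    unfolding weight_def using sum.reindex_bij_betw[OF bij_betw_walks[OF assms]] by metis
  also have "\<dots> = (\<Sum>g\<in>full_walks n D i j. walk_weight n i j g)"
    by (simp add: walk_weight_def)
  also have "\<dots> = (\<Sum>g\<in>full_walks n D i j. \<Prod>\<alpha>\<in>pieces n D. indet \<alpha> ^ card {k \<in> between n i j. g k = \<alpha>})"
  proof (rule sum.cong[OF refl walk_weight_fibers])
    fix g assume "g \<in> full_walks n D i j"
    then show "g ` between n i j \<subseteq> pieces n D"
      using between_props(1)[OF assms(2-4)] unfolding full_walks_def exact_walk_def by blast
  qed
  finally show ?thesis .
qed

lemma card_fibers_between:
  assumes "i \<in> {1..n}" "j \<in> {1..n}" "i \<noteq> j" "g \<in> full_walks n D i j" "\<alpha> \<in> pieces n D"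
  shows "card {k \<in> between n i j. g k = \<alpha>} + card {k \<in> between n j i. g k = \<alpha>} = card \<alpha> - 2"
proof -
  have "card {k \<in> {1..n} - {i, j}. g k = \<alpha>} = card \<alpha> - 2"
    using assms(4,5) by (simp add: full_walks_def exact_walk_def)
  moreover have "{k \<in> {1..n} - {i, j}. g k = \<alpha>} =
      {k \<in> between n i j. g k = \<alpha>} \<union> {k \<in> between n j i. g k = \<alpha>}"
    using between_props(1)[OF assms(1-3)] by blast
  moreover have "{k \<in> between n i j. g k = \<alpha>} \<inter> {k \<in> between n j i. g k = \<alpha>} = {}"
    using between_props(2)[OF assms(1-3)] by blast
  ultimately show ?thesis by (simp add: card_Un_disjoint finite_between)
qed

text \<open>Both weights are sums over the same exact walks, with complementary exponents term by
  term. For \<open>i = j\<close> there are no walks and both weights vanish.\<close>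

lemma complementing_weight:
  assumes "3 \<le> n" "i \<in> {1..n}" "j \<in> {1..n}" "dissection n D"
  shows "complementing n D (weight n D i j) = weight n D j i"
proof (cases "i = j")
  case True
  then show ?thesis by (simp add: weight_def walks_def complementing_zero)
next
  case False
  let ?c = "\<lambda>i j g \<alpha>. card {k \<in> between n i j. g k = \<alpha>}"
  have "complementing n D (\<Prod>\<alpha>\<in>pieces n D. indet \<alpha> ^ ?c i j g \<alpha>) =
      (\<Prod>\<alpha>\<in>pieces n D. indet \<alpha> ^ ?c j i g \<alpha>)" if g: "g \<in> full_walks n D i j" for g
  proof -
    note c = card_fibers_between[OF assms(2,3) False g]
    have "complementing n D (\<Prod>\<alpha>\<in>pieces n D. indet \<alpha> ^ ?c i j g \<alpha>) =
        (\<Prod>\<alpha>\<in>pieces n D. indet \<alpha> ^ (card \<alpha> - 2 - ?c i j g \<alpha>))"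
      by (rule complementing_indet_monomial) (use c in fastforce)
    also have "\<dots> = (\<Prod>\<alpha>\<in>pieces n D. indet \<alpha> ^ ?c j i g \<alpha>)"
      by (intro prod.cong refl) (simp flip: c)
    finally show ?thesis .
  qed
  then show ?thesis
    using weight_full_walks[OF assms(1,2,3) False assms(4)]
      weight_full_walks[OF assms(1,3,2) not_sym[OF False] assms(4)]
    by (simp add: complementing_sum full_walks_commute[of n D j i])
qed

theorem theorem3p5:
  fixes n :: nat and D :: "(nat \<times> nat) set"
  assumes "n \<ge> 3" and "dissection n D"
  shows "(\<forall>i\<in>{1..n}. \<forall>j\<in>{1..n}. complementing n D (weight n D i j) = weight n D j i) \<and>
    complementary_symmetric n D (weight_matrix n D)"
proof
  show *: "\<forall>i\<in>{1..n}. \<forall>j\<in>{1..n}. complementing n D (weight n D i j) = weight n D j i"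
    using complementing_weight assms by blast
  show "complementary_symmetric n D (weight_matrix n D)"
    unfolding complementary_symmetric_def weight_matrix_def
    by (rule eq_matI) (use * in \<open>simp_all add: transpose_mat_def\<close>)
qed

end
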